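(* Let $\mathbb K$ be an algebraically closed field of characteristic $0$, let $f(x,y)\in\mathbb K[x,y]$ be monic in $y$, let $\xi$ be a generic element of $\mathbb K$ and $f_\xi=f-\xi$. Then $$\operatorname{I}(f_\xi,f_y)=-\sum_{\sigma}\bigl(e(f_\sigma(\pi))-1\bigr)\lambda_\sigma,$$ where $\sigma$ runs through all split $\pi$-roots of $f_\xi$, and for each such $\sigma$ we write $f_\xi(\sigma)=f_\sigma(\pi)t^{\lambda_\sigma}+(\text{higher order terms in }t)$.
   Context: Put $x=t^{-1}$; for $h\in\mathbb K[x,y]$ write $h(y)$ for $h(t^{-1},y)$, regarded as a polynomial in $y$ over the Puiseux field $\mathbb K\ll t\gg$ (series $\sum a_jt^j$, $a_j\in\mathbb K$, exponents in $\frac1N\mathbb Z$ for some $N$ and bounded below); $\operatorname{ord}$ denotes the smallest exponent of $t$ with nonzero coefficient. For $h_1,h_2\in\mathbb K[x,y]$, the intersection number is $\operatorname{I}(h_1,h_2)=\deg_x\operatorname{Res}_y(h_1,h_2)$. Let $\pi$ be an indeterminate. A $\pi$-root of $h$ is an expression $\sigma=\sum_{j<\delta}a_jt^j+\pi t^{\delta}$ ($a_j\in\mathbb K$, $\delta\in\mathbb Q$) such that $h(\sigma)=h_\sigma(\pi)t^{\lambda}+(\text{higher order terms in }t)$ with $h_\sigma(\pi)\in\mathbb K[\pi]$ of positive degree; $\delta$ is its split order. The $\pi$-root $\sigma$ is split if $h_\sigma(\pi)$ has more than one distinct root. For $p(\pi)\in\mathbb K[\pi]$, $e(p(\pi))$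 denotes the number of distinct roots of $p(\pi)$. *)

theory Defs
  imports "Subresultants.Resultant_Prelim" "HOL-Library.Poly_Mapping"
begin

text \<open>Bivariate polynomials h in K[x,y] are represented as 'a poly poly: the outer variable
is y, the coefficients are polynomials in x.\<close>

text \<open>Finite Puiseux-type sums sum_e c_e t^e (rational exponents, finitely many terms),
with coefficients in 'b, represented as finitely supported maps rat to b (group algebra; the product is
convolution, i.e. t^a * t^b = t^(a+b)).\<close>

definition tpow :: "rat \<Rightarrow> 'b::zero_neq_one \<Rightarrow> (rat \<Rightarrow>\<^sub>0 'b)" where
  "tpow e c = Poly_Mapping.single e c"

text \<open>Substitution x = t^(-1): a polynomial c(x) in K[x] becomes sum_k c_k t^(-k),
with coefficients embedded as constant polynomials in the indeterminate pi.\<close>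

definition subst_x :: "'a::comm_ring_1 poly \<Rightarrow> (rat \<Rightarrow>\<^sub>0 'a poly)" where
  "subst_x c = (\<Sum>k\<le>degree c. tpow (- of_nat k) [:coeff c k:])"

definition eval_at :: "'a::comm_ring_1 poly poly \<Rightarrow> (rat \<Rightarrow>\<^sub>0 'a poly) \<Rightarrow> (rat \<Rightarrow>\<^sub>0 'a poly)" where
  "eval_at h s = poly (map_poly subst_x h) s"

text \<open>The pi-root expression sigma = sum_{j<delta} a_j t^j + pi t^delta, encoded by the pair
(a, delta), where a (finitely supported rat to a) records the coefficients a_j (all exponents < delta).\<close>

definition pi_expr :: "(rat \<Rightarrow>\<^sub>0 'a::comm_ring_1) \<Rightarrow> rat \<Rightarrow> (rat \<Rightarrow>\<^sub>0 'a poly)" where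
  "pi_expr a \<delta> = Poly_Mapping.map (\<lambda>c. [:c:]) a + tpow \<delta> [:0, 1:]"

definition ord_t :: "(rat \<Rightarrow>\<^sub>0 'b::zero) \<Rightarrow> rat" where
  "ord_t g = Min (Poly_Mapping.keys g)"

definition lead_pi :: "'a::comm_ring_1 poly poly \<Rightarrow> (rat \<Rightarrow>\<^sub>0 'a) \<times> rat \<Rightarrow> 'a poly" where
  "lead_pi h \<sigma> = (let g = eval_at h (pi_expr (fst \<sigma>) (snd \<sigma>)) in Poly_Mapping.lookup g (ord_t g))"

definition lam :: "'a::comm_ring_1 poly poly \<Rightarrow> (rat \<Rightarrow>\<^sub>0 'a) \<times> rat \<Rightarrow> rat" where
  "lam h \<sigma> = ord_t (eval_at h (pi_expr (fst \<sigma>) (snd \<sigma>)))"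

definition is_pi_root :: "'a::comm_ring_1 poly poly \<Rightarrow> (rat \<Rightarrow>\<^sub>0 'a) \<times> rat \<Rightarrow> bool" where
  "is_pi_root h \<sigma> \<longleftrightarrow>
     (\<forall>j\<in>Poly_Mapping.keys (fst \<sigma>). j < snd \<sigma>) \<and>
     eval_at h (pi_expr (fst \<sigma>) (snd \<sigma>)) \<noteq> 0 \<and>
     degree (lead_pi h \<sigma>) > 0"

definition n_roots :: "'a::comm_ring_1 poly \<Rightarrow> nat" where
  "n_roots p = card {z. poly p z = 0}"

definition is_split_pi_root :: "'a::comm_ring_1 poly poly \<Rightarrow> (rat \<Rightarrow>\<^sub>0 'a) \<times> rat \<Rightarrow> bool" where
  "is_split_pi_root h \<sigma> \<longleftrightarrow> is_pi_root h \<sigma> \<and> n_roots (lead_pi h \<sigma>) > 1"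

definition int_num :: "'a::comm_ring_1 poly poly \<Rightarrow> 'a poly poly \<Rightarrow> nat" where
  "int_num h1 h2 = degree (resultant h1 h2)"

end

theory Submission
  imports Defs "Subresultants.Subresultant"
begin

text \<open>
  Finite Puiseux sums suffice in place of Puiseux series.  Newton's substitutions
  $y \mapsto c + t^r y$ and Hensel lifting split a monic polynomial into linear factors modulo
  $t^M$, for every $M$.  Let $Y$ be the set of approximate roots of $f_\xi$.  For generic $\xi$ the
  resultant of $f_\xi$ and $f_y$ does not vanish; for large $M$ its order is then the order of the
  discriminant of the approximation, so $Y$ has $n$ elements and
  $-\mathrm{I}(f_\xi, f_y) = \sum_{y \in Y} \sum_{z \in Y, z \neq y} \mathrm{ord}(y - z)$.

  For large $M$, moreover, the leading term of $f_\xi(\sigma)$ is that of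
  $\prod_{y \in Y} (\sigma - y)$.  Hence the split $\pi$-roots are the branch nodes of the tree of
  approximate roots, $e(f_\sigma)$ is the number of branches at the node, and $\lambda_\sigma$ is
  the sum over $y \in Y$ of the contact $\min(\delta, \mathrm{ord}(y - a))$ of $y$ with
  $\sigma = a + \pi t^\delta$.  It remains to see that for each fixed $y$
  \[ \sum_\sigma (e(f_\sigma) - 1)\, \mathrm{contact}(\sigma, y) = \sum_{z \neq y} \mathrm{ord}(y - z). \]
  Add the leaves $z \neq y$ one at a time: a new leaf raises the number of branches by one at
  exactly one node, the point where it leaves the tree, and the contact of that node with $y$
  is $\mathrm{ord}(y - z)$.
\<close>

text \<open>Roots of a polynomial over finite Puiseux sums need not be finite sums, so only
  approximate roots \<open>Y\<close> of some precision \<open>M\<close> are available, and they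
  change with \<open>M\<close>. This creates a circularity: the precision needed to trust the
  leading term at a node grows with the exponent \<delta> of the node, while the nodes depend on
  \<open>Y\<close>, hence on \<open>M\<close>. The discriminant breaks it. Its order, the sum of the
  orders of all differences, does not depend on \<open>M\<close>, and each difference has order at
  least \<open>- c\<close> with \<open>c\<close> read off from the polynomial alone. So no single
  order, and no \<delta> of a branch node, exceeds a bound fixed in advance. Genericity enters
  through approximate roots \<open>r\<close> of the derivative: up to a unit and a small error the
  resultant is the product of the \<open>f(r) - \<xi>\<close>, so it suffices that \<xi> avoids the
  constant coefficients of the finitely many \<open>f(r)\<close>.\<close>

declare coeff_lift_hom.hom_one [simp del]

section \<open>Orders of Puiseux sums\<close>

abbreviation (input) lookup :: "(rat \<Rightarrow>\<^sub>0 'b::zero) \<Rightarrow> rat \<Rightarrow> 'b" where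
  "lookup \<equiv> Poly_Mapping.lookup"

abbreviation (input) keys :: "(rat \<Rightarrow>\<^sub>0 'b::zero) \<Rightarrow> rat set" where
  "keys \<equiv> Poly_Mapping.keys"

type_synonym 'b puiseux = "rat \<Rightarrow>\<^sub>0 'b"

text \<open>\<open>ord_t 0\<close> is an unspecified minimum over the empty set. As a condition on
  all exponents, the bound on the order also makes sense for 0 and for differences that may
  vanish.\<close>

definition vge :: "rat \<Rightarrow> 'b::zero puiseux \<Rightarrow> bool" where
  "vge r g \<longleftrightarrow> (\<forall>k. lookup g k \<noteq> 0 \<longrightarrow> r \<le> k)"

definition vgt :: "rat \<Rightarrow> 'b::zero puiseux \<Rightarrow> bool" where
  "vgt r g \<longleftrightarrow> (\<forall>k. lookup g k \<noteq> 0 \<longrightarrow> r < k)"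

lemma vge_0[simp]: "vge r 0" and vgt_0[simp]: "vgt r 0"
  by (auto simp: vge_def vgt_def)

lemma vge_mono: "vge r g \<Longrightarrow> s \<le> r \<Longrightarrow> vge s g"
  by (force simp: vge_def)

lemma vgt_imp_vge: "vgt r g \<Longrightarrow> vge r g"
  by (force simp: vge_def vgt_def)

lemma vge_imp_vgt: "vge s g \<Longrightarrow> r < s \<Longrightarrow> vgt r g"
  by (force simp: vge_def vgt_def)

lemma vge_single[simp]: "vge r (Poly_Mapping.single s c) \<longleftrightarrow> c = 0 \<or> r \<le> s"
  by (auto simp: vge_def lookup_single when_def)

lemma vge_one[simp]: "vge r (1 :: 'b::zero_neq_one puiseux) \<longleftrightarrow> r \<le> 0"
  by (auto simp: vge_def lookup_one when_def)

lemma vge_one_comm_semiring: "r \<le> 0 \<Longrightarrow> vge r (1 :: 'b::comm_semiring_1 puiseux)"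
  by (auto simp: vge_def lookup_one when_def)

lemma vge_add: "vge r f \<Longrightarrow> vge r g \<Longrightarrow> vge r (f + g)" for f g :: "'b::monoid_add puiseux"
  unfolding vge_def lookup_add by (metis add_0)

lemma vge_diff: "vge r f \<Longrightarrow> vge r g \<Longrightarrow> vge r (f - g)" for f g :: "'b::ab_group_add puiseux"
  unfolding vge_def lookup_minus by (metis diff_0_right)

lemma vge_uminus[simp]: "vge r (- f) \<longleftrightarrow> vge r f" for f :: "'b::ab_group_add puiseux"
  by (force simp: vge_def)

lemma vge_sum: "(\<And>i. i \<in> I \<Longrightarrow> vge r (f i)) \<Longrightarrow> vge r (\<Sum>i\<in>I. f i)"
  for f :: "_ \<Rightarrow> 'b::comm_monoid_add puiseux"
  by (induction I rule: infinite_finite_induct) (auto intro: vge_add)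

lemma lookup_mult_nonzeroE:
  assumes "lookup (f * g) k \<noteq> 0"
  obtains a b where "k = a + b" "lookup f a \<noteq> 0" "lookup g b \<noteq> 0"
  using assms keys_mult[of f g] by (force simp: in_keys_iff)

lemma vge_mult:
  fixes f g :: "'b::semiring_0 puiseux"
  assumes "vge r f" "vge s g"
  shows "vge (r + s) (f * g)"
  using assms unfolding vge_def by (metis lookup_mult_nonzeroE add_mono)

lemma vgt_mult_left:
  fixes f g :: "'b::semiring_0 puiseux"
  assumes "vgt r f" "vge s g"
  shows "vgt (r + s) (f * g)"
  using assms unfolding vge_def vgt_def by (metis lookup_mult_nonzeroE add_less_le_mono)

lemma vge_prod:
  fixes f :: "_ \<Rightarrow> 'b::comm_semiring_1 puiseux"
  assumes "\<And>i. i \<in> I \<Longrightarrow> vge (r i) (f i)"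
  shows "vge (sum r I) (prod f I)"
  using assms by (induction I rule: infinite_finite_induct)
    (auto intro!: vge_mult simp: vge_one_comm_semiring)

lemma vge_power: "vge r f \<Longrightarrow> vge (of_nat n * r) (f ^ n)" for f :: "'b::comm_semiring_1 puiseux"
proof (induction n)
  case 0
  then show ?case by (simp add: vge_def lookup_one when_def)
next
  case (Suc n)
  from vge_mult[OF Suc.prems Suc.IH[OF Suc.prems]] show ?case by (simp add: algebra_simps)
qed

lemma vge_split:
  fixes f :: "'b::ab_group_add puiseux"
  assumes "vge r f"
  shows "vgt r (f - Poly_Mapping.single r (lookup f r))"
  using assms by (auto simp: vge_def vgt_def lookup_minus lookup_single when_def order.strict_iff_order)

lemma vgt_lookup: "vgt r f \<Longrightarrow> lookup f r = 0"
  by (auto simp: vgt_def)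

text \<open>The bounds \<open>r\<close> and \<open>s\<close> need not be the exact orders: what
  remains of a factor after removing its term at the bound only contributes above
  \<open>r + s\<close>.\<close>

lemma lookup_mult_lowest:
  fixes f g :: "'b::comm_ring_1 puiseux"
  assumes "vge r f" "vge s g"
  shows "lookup (f * g) (r + s) = lookup f r * lookup g s"
proof -
  let ?f = "Poly_Mapping.single r (lookup f r)" and ?g = "Poly_Mapping.single s (lookup g s)"
  have "f * g = ?f * ?g + (g - ?g) * ?f + (f - ?f) * g"
    by (simp add: algebra_simps)
  moreover have "vgt (s + r) ((g - ?g) * ?f)"
    by (rule vgt_mult_left[OF vge_split]) (use assms in auto)
  moreover have "vgt (r + s) ((f - ?f) * g)"
    by (rule vgt_mult_left[OF vge_split]) (use assms in auto)
  ultimately show ?thesis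
    by (simp add: lookup_add vgt_lookup add.commute mult_single)
qed

lemma lookup_prod_lowest:
  fixes f :: "_ \<Rightarrow> 'b::comm_ring_1 puiseux"
  assumes "finite I" "\<And>i. i \<in> I \<Longrightarrow> vge (r i) (f i)"
  shows "lookup (prod f I) (sum r I) = (\<Prod>i\<in>I. lookup (f i) (r i))"
  using assms by (induction I rule: finite_induct) (simp_all add: lookup_mult_lowest vge_prod)

lemma vge_exists: "\<exists>c\<ge>0. vge (- c) g"
proof -
  have fin: "finite (insert 0 (keys g))" by simp
  let ?m = "Min (insert 0 (keys g))"
  have "?m \<le> 0" using fin by (simp del: Min_insert)
  moreover have "vge ?m g"
    using fin unfolding vge_def by (auto simp: in_keys_iff simp del: Min_insert intro!: Min_le)
  ultimately show ?thesis by (intro exI[of _ "- ?m"]) (simp only: minus_minus neg_0_le_iff_le)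
qed

text \<open>Finite support keeps a positive order away from 0; the extra element 1 serves the empty
  support. The resulting \<epsilon> is the step width of Hensel lifting.\<close>

lemma vgt_0_gap:
  assumes "vgt 0 g"
  shows "\<exists>\<epsilon>>0. vge \<epsilon> g"
proof -
  have fin: "finite (insert 1 (keys g))" by simp
  let ?m = "Min (insert 1 (keys g))"
  have "?m > 0" using fin assms by (simp del: Min_insert add: vgt_def in_keys_iff)
  moreover have "vge ?m g"
    using fin unfolding vge_def by (auto simp: in_keys_iff simp del: Min_insert intro!: Min_le)
  ultimately show ?thesis by blast
qed

lemma ord_t_eqI: "vge r g \<Longrightarrow> lookup g r \<noteq> 0 \<Longrightarrow> ord_t g = r"
  unfolding ord_t_def vge_def by (intro Min_eqI) (auto simp: in_keys_iff)

lemma ord_t_nonzero: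
  assumes "g \<noteq> 0"
  shows "vge (ord_t g) g" "lookup g (ord_t g) \<noteq> 0"
proof -
  have "keys g \<noteq> {}" using assms by simp
  then have "ord_t g \<in> keys g" unfolding ord_t_def by (intro Min_in) auto
  then show "lookup g (ord_t g) \<noteq> 0" by (simp add: in_keys_iff)
  show "vge (ord_t g) g" unfolding ord_t_def vge_def by (auto simp: in_keys_iff)
qed

lemma vge_ord_t: "vge r g \<Longrightarrow> g \<noteq> 0 \<Longrightarrow> r \<le> ord_t g"
  using ord_t_nonzero(2)[of g] by (simp add: vge_def)

lemma ord_t_le: "lookup g k \<noteq> 0 \<Longrightarrow> ord_t g \<le> k"
  unfolding ord_t_def by (intro Min_le) (auto simp: in_keys_iff)

lemma ord_t_mult:
  fixes f g :: "'b::idom puiseux"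
  assumes "f \<noteq> 0" "g \<noteq> 0"
  shows "ord_t (f * g) = ord_t f + ord_t g"
  using ord_t_nonzero[OF assms(1)] ord_t_nonzero[OF assms(2)]
  by (intro ord_t_eqI vge_mult) (auto simp: lookup_mult_lowest)

lemma ord_t_one: "ord_t (1 :: 'b::zero_neq_one puiseux) = 0"
  by (rule ord_t_eqI) auto

lemma ord_t_uminus: "ord_t (- f) = ord_t f" for f :: "'b::ab_group_add puiseux"
  by (simp add: ord_t_def keys_def)

lemma ord_t_prod:
  fixes f :: "_ \<Rightarrow> 'b::idom puiseux"
  assumes "\<And>i. i \<in> I \<Longrightarrow> f i \<noteq> 0"
  shows "ord_t (prod f I) = (\<Sum>i\<in>I. ord_t (f i))"
  using assms by (induction I rule: infinite_finite_induct) (auto simp: ord_t_one ord_t_mult)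

lemma ord_t_add_higher:
  fixes f g :: "'b::ab_group_add puiseux"
  assumes "f \<noteq> 0" "vgt (ord_t f) g"
  shows "ord_t (f + g) = ord_t f" "lookup (f + g) (ord_t f) = lookup f (ord_t f)" "f + g \<noteq> 0"
proof -
  show l: "lookup (f + g) (ord_t f) = lookup f (ord_t f)"
    using vgt_lookup[OF assms(2)] by (simp add: lookup_add)
  then show "ord_t (f + g) = ord_t f" using assms ord_t_nonzero[OF assms(1)]
    by (intro ord_t_eqI vge_add) (auto intro: vgt_imp_vge)
  show "f + g \<noteq> 0" using l ord_t_nonzero(2)[OF assms(1)] by auto
qed

section \<open>Coefficientwise homomorphisms\<close>

lemma puiseux_sum_single: "g = (\<Sum>k\<in>keys g. Poly_Mapping.single k (lookup g k))"
  by (rule poly_mapping_eqI) (auto simp: lookup_sum lookup_single when_def in_keys_iff)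

context comm_ring_hom
begin

lemma lookup_map_hom: "lookup (Poly_Mapping.map hom g) k = hom (lookup g k)"
  by (simp add: Poly_Mapping.map.rep_eq when_def)

lemma map_hom_single: "Poly_Mapping.map hom (Poly_Mapping.single k c) = Poly_Mapping.single k (hom c)"
  by (rule poly_mapping_eqI) (simp add: lookup_map_hom lookup_single when_def)

lemma map_hom_add: "Poly_Mapping.map hom (f + g :: 'a puiseux) = Poly_Mapping.map hom f + Poly_Mapping.map hom g"
  by (rule poly_mapping_eqI) (simp add: lookup_map_hom lookup_add hom_add)

lemma map_hom_0: "Poly_Mapping.map hom (0 :: 'a puiseux) = 0"
  by (rule poly_mapping_eqI) (simp add: lookup_map_hom)

lemma map_hom_sum: "Poly_Mapping.map hom (\<Sum>i\<in>I. f i :: 'a puiseux) = (\<Sum>i\<in>I. Poly_Mapping.map hom (f i))"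
  by (induction I rule: infinite_finite_induct) (auto simp: map_hom_add map_hom_0)

lemma map_hom_mult:
  "Poly_Mapping.map hom (f * g) = Poly_Mapping.map hom f * Poly_Mapping.map hom (g :: 'a puiseux)"
proof -
  have "f * g = (\<Sum>k\<in>keys f. \<Sum>l\<in>keys g. Poly_Mapping.single k (lookup f k) * Poly_Mapping.single l (lookup g l))"
    by (subst puiseux_sum_single[of f], subst puiseux_sum_single[of g]) (simp add: sum_product)
  also have "Poly_Mapping.map hom \<dots> = (\<Sum>k\<in>keys f. \<Sum>l\<in>keys g.
      Poly_Mapping.map hom (Poly_Mapping.single k (lookup f k)) * Poly_Mapping.map hom (Poly_Mapping.single l (lookup g l)))"
    by (simp add: map_hom_sum mult_single map_hom_single hom_mult)
  also have "\<dots> = Poly_Mapping.map hom (\<Sum>k\<in>keys f. Poly_Mapping.single k (lookup f k)) *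
      Poly_Mapping.map hom (\<Sum>l\<in>keys g. Poly_Mapping.single l (lookup g l))"
    by (simp add: map_hom_sum sum_product)
  finally show ?thesis by (simp add: puiseux_sum_single[symmetric])
qed

lemma map_hom_comm_ring_hom: "comm_ring_hom (Poly_Mapping.map hom :: 'a puiseux \<Rightarrow> 'b puiseux)"
proof unfold_locales
  show "Poly_Mapping.map hom (1 :: 'a puiseux) = 1"
    by (rule poly_mapping_eqI) (simp add: lookup_map_hom lookup_one when_def)
qed (auto simp: map_hom_add map_hom_mult map_hom_0)

lemma vge_map_hom: "vge r g \<Longrightarrow> vge r (Poly_Mapping.map hom g)"
  unfolding vge_def lookup_map_hom by (metis hom_zero)

end

section \<open>Polynomials over Puiseux sums\<close>

definition pvge :: "rat \<Rightarrow> 'b::zero puiseux poly \<Rightarrow> bool" where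
  "pvge r p \<longleftrightarrow> (\<forall>i. vge r (coeff p i))"

lemma pvge_0[simp]: "pvge r 0"
  by (simp add: pvge_def)

lemma pvge_1[simp]: "pvge r (1 :: 'b::comm_ring_1 puiseux poly) \<longleftrightarrow> r \<le> 0"
  unfolding pvge_def by (simp split: if_splits)

lemma pvge_mono: "pvge r p \<Longrightarrow> s \<le> r \<Longrightarrow> pvge s p"
  by (auto simp: pvge_def intro: vge_mono)

lemma pvge_add: "pvge r p \<Longrightarrow> pvge r q \<Longrightarrow> pvge r (p + q)"
  for p q :: "'b::comm_ring_1 puiseux poly"
  by (auto simp: pvge_def intro: vge_add)

lemma pvge_diff: "pvge r p \<Longrightarrow> pvge r q \<Longrightarrow> pvge r (p - q)"
  for p q :: "'b::comm_ring_1 puiseux poly"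
  by (auto simp: pvge_def intro: vge_diff)

lemma pvge_sum: "(\<And>i. i \<in> I \<Longrightarrow> pvge r (f i)) \<Longrightarrow> pvge r (\<Sum>i\<in>I. f i)"
  for f :: "_ \<Rightarrow> 'b::comm_ring_1 puiseux poly"
  by (induction I rule: infinite_finite_induct) (auto intro: pvge_add)

lemma pvge_mult: "pvge r p \<Longrightarrow> pvge s q \<Longrightarrow> pvge (r + s) (p * q)"
  for p q :: "'b::comm_ring_1 puiseux poly"
  by (auto simp: pvge_def coeff_mult intro!: vge_sum vge_mult)

lemma pvge_smult: "vge r c \<Longrightarrow> pvge s q \<Longrightarrow> pvge (r + s) (smult c q)"
  for q :: "'b::comm_ring_1 puiseux poly"
  by (auto simp: pvge_def intro!: vge_mult)

lemma pvge_exists: "\<exists>c\<ge>0. pvge (- c) p"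
proof (induction p rule: pCons_induct)
  case 0
  show ?case by (intro exI[of _ 0]) simp
next
  case (pCons a p)
  obtain c d where c: "c \<ge> 0" "pvge (- c) p" and d: "d \<ge> 0" "vge (- d) a"
    using pCons.IH vge_exists[of a] by blast
  have "pvge (- max c d) (pCons a p)"
    using c(2) d(2) by (auto simp: pvge_def coeff_pCons intro: vge_mono split: nat.split)
  then show ?case using c(1) by (intro exI[of _ "max c d"]) auto
qed

lemma pvge_eval:
  fixes p :: "'b::comm_ring_1 puiseux poly"
  assumes "pvge r p" "degree p \<le> n" "c \<ge> 0" "vge (- c) s"
  shows "vge (r - of_nat n * c) (poly p s)"
  unfolding poly_altdef
proof (rule vge_sum)
  fix i assume "i \<in> {..degree p}"
  then have "of_nat i * c \<le> of_nat n * c" using assms by (intro mult_right_mono) auto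
  moreover have "vge (r + of_nat i * - c) (coeff p i * s ^ i)"
    using assms by (intro vge_mult vge_power) (auto simp: pvge_def)
  ultimately show "vge (r - of_nat n * c) (coeff p i * s ^ i)"
    by (elim vge_mono) (simp add: algebra_simps)
qed

text \<open>The loss \<open>L\<close> depends on \<open>q\<close> and the degree bound only, not on
  \<open>M\<close> or \<open>p\<close>, so it can be compensated by asking for a higher precision
  beforehand.\<close>

lemma pvge_pcompose_loss:
  fixes q :: "'b::comm_ring_1 puiseux poly"
  shows "\<exists>L. \<forall>M p. degree p \<le> n \<longrightarrow> pvge M p \<longrightarrow> pvge (M - L) (pcompose p q)"
proof -
  obtain c where c: "c \<ge> 0" "pvge (- c) q" using pvge_exists by blast
  have pow: "pvge (- (of_nat i * c)) (q ^ i)" for i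
  proof (induction i)
    case (Suc i)
    from pvge_mult[OF c(2) this] show ?case by (simp add: algebra_simps)
  qed simp
  have "pvge (M - of_nat n * c) (pcompose p q)" if "degree p \<le> n" "pvge M p" for M p
    unfolding pcompose_altdef poly_altdef
  proof (rule pvge_sum)
    fix i assume i: "i \<in> {..degree (map_poly (\<lambda>c. [:c:]) p)}"
    have "degree (map_poly (\<lambda>c. [:c:]) p) \<le> degree p" by (rule degree_map_poly_le)
    with i that have "of_nat i * c \<le> of_nat n * c" using c by (intro mult_right_mono) auto
    moreover have "pvge (M + - (of_nat i * c)) (smult (coeff p i) (q ^ i))"
      by (rule pvge_smult[OF _ pow]) (use that in \<open>auto simp: pvge_def\<close>)
    ultimately show "pvge (M - of_nat n * c) (coeff (map_poly (\<lambda>c. [:c:]) p) i * q ^ i)"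
      by (auto simp: coeff_map_poly elim: pvge_mono)
  qed
  then show ?thesis by blast
qed

section \<open>Hensel lifting\<close>

interpretation single_hom: inj_comm_ring_hom "Poly_Mapping.single 0 :: 'b::comm_ring_1 \<Rightarrow> 'b puiseux"
  by unfold_locales (auto simp: single_add mult_single, metis lookup_single_eq lookup_zero)

interpretation single_poly_hom: map_poly_inj_comm_ring_hom "Poly_Mapping.single 0 :: 'b::comm_ring_1 \<Rightarrow> 'b puiseux" ..

lemma single_power: "Poly_Mapping.single r c ^ n = Poly_Mapping.single (of_nat n * r) (c ^ n)"
  for c :: "'b::comm_ring_1"
  by (induction n) (auto simp: mult_single algebra_simps)

lemma pvge_pconst: "pvge 0 (map_poly (Poly_Mapping.single 0) p)"
  by (simp add: pvge_def coeff_map_poly)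

lemma pvge_gap: "(\<And>i. vgt 0 (coeff p i)) \<Longrightarrow> \<exists>\<epsilon>>0. pvge \<epsilon> p"
proof (induction p rule: pCons_induct)
  case 0
  show ?case by (intro exI[of _ 1]) simp
next
  case (pCons a p)
  have "vgt 0 a" "vgt 0 (coeff p i)" for i
    using pCons.prems[of 0] pCons.prems[of "Suc i"] by simp_all
  then obtain c d where c: "c > 0" "pvge c p" and d: "d > 0" "vge d a"
    using pCons.IH vgt_0_gap[of a] by blast
  have "pvge (min c d) (pCons a p)"
    using c(2) d(2) by (auto simp: pvge_def coeff_pCons intro: vge_mono split: nat.split)
  then show ?case using c(1) d(1) by (intro exI[of _ "min c d"]) auto
qed

lemma degree_monic_diff_less:
  fixes p q :: "'b::comm_ring_1 poly"
  assumes "monic p" "monic q" "degree p = n" "degree q = n" "n > 0"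
  shows "degree (p - q) < n"
proof -
  have "degree (p - q) \<le> n" using degree_diff_le[of p n q] assms by simp
  moreover have "coeff (p - q) n = 0" using assms by simp
  ultimately show ?thesis using assms(5)
    by (metis coeff_0_degree_minus_1 le_antisym leading_coeff_0_iff less_le degree_0 not_le)
qed

lemma monic_add_lower:
  fixes p q :: "'b::comm_ring_1 poly"
  assumes "monic p" "degree q < degree p"
  shows "monic (p + q)" "degree (p + q) = degree p"
  using assms by (simp_all add: degree_add_eq_left coeff_eq_0)

text \<open>Multiply the Bezout identity by the monomial and reduce the cofactor of \<open>h\<close>
  modulo \<open>g\<close>; comparing degrees then bounds the cofactor of \<open>g\<close>.\<close>

lemma bezout_monom_split:
  fixes g h :: "'a::field poly"
  assumes bez: "u * h + w * g = 1" and "degree g > 0" "degree h > 0" and i: "i < degree g + degree h"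
  shows "\<exists>a b. degree a < degree g \<and> degree b < degree h \<and> monom 1 i = a * h + b * g"
proof -
  have g0: "g \<noteq> 0" using assms by auto
  obtain q a where qa: "monom 1 i * u = q * g + a" "degree a < degree g"
  proof
    show "monom 1 i * u = (monom 1 i * u) div g * g + (monom 1 i * u) mod g" by simp
    show "degree ((monom 1 i * u) mod g) < degree g"
      using degree_mod_less[OF g0, of "monom 1 i * u"] assms(2) by auto
  qed
  let ?b = "monom 1 i * w + q * h"
  have "monom 1 i = monom 1 i * (u * h + w * g)" by (simp add: bez)
  also have "\<dots> = (monom 1 i * u) * h + monom 1 i * w * g" by (simp only: distrib_left mult.assoc)
  finally have eq: "monom 1 i = a * h + ?b * g" unfolding qa(1) by (simp add: algebra_simps)
  have "degree ?b < degree h"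
  proof (cases "?b = 0")
    case False
    have "degree (a * h) < degree g + degree h"
      using qa(2) degree_mult_le[of a h] by linarith
    then have "degree (monom 1 i - a * h) < degree g + degree h"
      using i by (intro degree_diff_less) (auto simp: degree_monom_eq)
    moreover have "monom 1 i - a * h = ?b * g" using eq unfolding diff_eq_eq add.commute[of "a * h"] .
    ultimately show ?thesis using False g0 by (simp add: degree_mult_eq)
  qed (use assms in simp)
  with eq qa(2) show ?thesis by blast
qed

text \<open>Splitting the monomials over the field and recombining them with the coefficients of \<open>E\<close>
  avoids a division over the ring of Puiseux sums and keeps the order \<open>r\<close>.\<close>

lemma hensel_correction:
  fixes E :: "'a::field puiseux poly" and g h :: "'a poly"
  assumes bez: "u * h + w * g = 1" and gh: "degree g > 0" "degree h > 0"
    and E: "degree E < degree g + degree h" "pvge r E"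
  shows "\<exists>A B. degree A < degree g \<and> degree B < degree h \<and> pvge r A \<and> pvge r B \<and>
    E = A * map_poly (Poly_Mapping.single 0) h + B * map_poly (Poly_Mapping.single 0) g"
proof -
  let ?c = "map_poly (Poly_Mapping.single 0) :: 'a poly \<Rightarrow> 'a puiseux poly"
  have "\<forall>i. \<exists>ab. i \<le> degree E \<longrightarrow> degree (fst ab) < degree g \<and> degree (snd ab) < degree h \<and>
      monom 1 i = fst ab * h + snd ab * g"
    using bezout_monom_split[OF bez gh] E(1) by auto
  from choice[OF this] obtain ab where ab: "\<And>i. i \<le> degree E \<Longrightarrow> degree (fst (ab i)) < degree g \<and>
      degree (snd (ab i)) < degree h \<and> monom 1 i = fst (ab i) * h + snd (ab i) * g"
    by blast
  define A where "A = (\<Sum>i\<le>degree E. smult (coeff E i) (?c (fst (ab i))))"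
  define B where "B = (\<Sum>i\<le>degree E. smult (coeff E i) (?c (snd (ab i))))"
  have "degree A < degree g" unfolding A_def
    using ab gh by (intro degree_sum_less) (auto intro!: le_less_trans[OF degree_smult_le])
  moreover have "degree B < degree h" unfolding B_def
    using ab gh by (intro degree_sum_less) (auto intro!: le_less_trans[OF degree_smult_le])
  moreover have "pvge r (smult (coeff E i) (?c q))" for i q
    using pvge_smult[OF _ pvge_pconst, of r "coeff E i" q] E(2) by (simp add: pvge_def)
  then have "pvge r A" "pvge r B" unfolding A_def B_def
    by (auto intro!: pvge_sum)
  moreover have "E = A * ?c h + B * ?c g"
  proof -
    have "E = (\<Sum>i\<le>degree E. smult (coeff E i) (?c (monom 1 i)))"
      by (subst poly_as_sum_of_monoms[symmetric]) (simp add: map_poly_monom smult_monom)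
    also have "\<dots> = (\<Sum>i\<le>degree E. smult (coeff E i) (?c (fst (ab i)) * ?c h + ?c (snd (ab i)) * ?c g))"
      by (intro sum.cong refl) (use ab in \<open>simp flip: single_poly_hom.hom_mult single_poly_hom.hom_add\<close>)
    also have "\<dots> = A * ?c h + B * ?c g"
      by (simp add: A_def B_def sum_distrib_right smult_add_right sum.distrib)
    finally show ?thesis .
  qed
  ultimately show ?thesis by blast
qed

text \<open>Every correction is computed against the fixed residues \<open>g\<close> and
  \<open>h\<close> instead of the current factors. The error of doing so consists of products of a
  correction with a term of order at least \<epsilon>, so each round still gains \<epsilon>, the
  least order in \<open>p - g * h\<close>.\<close>

lemma hensel_approx:
  fixes p :: "'a::field puiseux poly" and g h :: "'a poly"
  assumes p: "monic p" "pvge 0 p" "map_poly (\<lambda>c. lookup c 0) p = g * h"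
    and bez: "u * h + w * g = 1" and gh: "monic g" "monic h" "degree g > 0" "degree h > 0"
  shows "\<exists>G H. monic G \<and> monic H \<and> degree G = degree g \<and> degree H = degree h \<and>
    pvge 0 G \<and> pvge 0 H \<and> pvge M (p - G * H)"
proof -
  let ?c = "map_poly (Poly_Mapping.single 0) :: 'a poly \<Rightarrow> 'a puiseux poly"
  have "degree p = degree (g * h)"
    unfolding p(3)[symmetric] by (rule map_poly_degree_eq[symmetric]) (simp add: p(1))
  then have dp: "degree p = degree g + degree h"
    using gh by (subst (asm) degree_monic_mult) auto
  have "vgt 0 (coeff (p - ?c (g * h)) i)" for i
    using vge_split[of 0 "coeff p i"] p(2) by (simp add: coeff_map_poly p(3)[symmetric] pvge_def)
  then obtain \<epsilon> where eps: "\<epsilon> > 0" "pvge \<epsilon> (p - ?c (g * h))" using pvge_gap by blast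
  have step: "\<exists>G H. monic G \<and> monic H \<and> degree G = degree g \<and> degree H = degree h \<and>
    pvge \<epsilon> (G - ?c g) \<and> pvge \<epsilon> (H - ?c h) \<and> pvge (of_nat (Suc k) * \<epsilon>) (p - G * H)" for k
  proof (induction k)
    case 0
    show ?case
      by (intro exI[of _ "?c g"] exI[of _ "?c h"]) (use gh eps in \<open>simp add: single_poly_hom.hom_mult coeff_map_poly\<close>)
  next
    case (Suc k)
    then obtain G H where GH: "monic G" "monic H" "degree G = degree g" "degree H = degree h"
      "pvge \<epsilon> (G - ?c g)" "pvge \<epsilon> (H - ?c h)" "pvge (of_nat (Suc k) * \<epsilon>) (p - G * H)" by blast
    have dm: "degree (G * H) = degree g + degree h"
      using GH gh by (subst degree_monic_mult) auto
    have "degree (p - G * H) < degree g + degree h"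
      using p(1) monic_mult[OF GH(1,2)] gh dp dm by (intro degree_monic_diff_less) auto
    from hensel_correction[OF bez gh(3,4) this GH(7)] obtain A B where
      AB: "degree A < degree g" "degree B < degree h" "pvge (of_nat (Suc k) * \<epsilon>) A"
        "pvge (of_nat (Suc k) * \<epsilon>) B" "p - G * H = A * ?c h + B * ?c g" by blast
    have le: "\<epsilon> \<le> of_nat (Suc k) * \<epsilon>" using eps(1) by (simp add: algebra_simps)
    have AB': "pvge \<epsilon> A" "pvge \<epsilon> B" using AB(3,4) le by (auto intro: pvge_mono)
    have "p - (G + A) * (H + B) = (p - G * H) - A * H - B * G - A * B" by (simp add: algebra_simps)
    also have "\<dots> = - (A * (H - ?c h)) - B * (G - ?c g) - A * B"
      unfolding AB(5) by (simp add: algebra_simps)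
    finally have eq: "p - (G + A) * (H + B) = 0 - A * (H - ?c h) - B * (G - ?c g) - A * B" by simp
    have r: "of_nat (Suc (Suc k)) * \<epsilon> = of_nat (Suc k) * \<epsilon> + \<epsilon>" by (simp add: algebra_simps)
    have "pvge (of_nat (Suc (Suc k)) * \<epsilon>) (p - (G + A) * (H + B))"
      unfolding eq r by (intro pvge_diff pvge_0 pvge_mult[OF AB(3) GH(6)] pvge_mult[OF AB(4) GH(5)]
          pvge_mult[OF AB(3) AB'(2)])
    moreover have "pvge \<epsilon> (G + A - ?c g)" "pvge \<epsilon> (H + B - ?c h)"
      using pvge_add[OF GH(5) AB'(1)] pvge_add[OF GH(6) AB'(2)] by (simp_all add: algebra_simps)
    ultimately show ?case using monic_add_lower[of G A] monic_add_lower[of H B] GH AB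
      by (intro exI[of _ "G + A"] exI[of _ "H + B"]) auto
  qed
  obtain k where "M / \<epsilon> \<le> of_nat k" using real_arch_simple by blast
  then have k: "M \<le> of_nat (Suc k) * \<epsilon>" using eps(1) by (simp add: field_simps)
  obtain G H where GH: "monic G" "monic H" "degree G = degree g" "degree H = degree h"
      "pvge \<epsilon> (G - ?c g)" "pvge \<epsilon> (H - ?c h)" "pvge (of_nat (Suc k) * \<epsilon>) (p - G * H)"
    using step[of k] by blast
  have "pvge 0 (G - ?c g)" "pvge 0 (H - ?c h)" using GH eps by (auto intro: pvge_mono)
  from pvge_add[OF this(1) pvge_pconst[of g]] pvge_add[OF this(2) pvge_pconst[of h]]
  have "pvge 0 G" "pvge 0 H" by simp_all
  with GH k show ?thesis by (blast intro: pvge_mono)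
qed

section \<open>The Newton--Puiseux theorem modulo powers of t\<close>

definition lin_prod :: "'b::comm_ring_1 list \<Rightarrow> 'b poly" where
  "lin_prod ys = (\<Prod>y\<leftarrow>ys. [:- y, 1:])"

lemma lin_prod_simps[simp]: "lin_prod [] = 1" "lin_prod (y # ys) = [:- y, 1:] * lin_prod ys"
  "lin_prod (ys @ zs) = lin_prod ys * lin_prod zs"
  by (simp_all add: lin_prod_def)

text \<open>The genuine roots may be infinite series, so the list of roots is only required up to
  precision \<open>M\<close> and may vary with it.\<close>

definition splits_approx :: "'b::comm_ring_1 puiseux poly \<Rightarrow> bool" where
  "splits_approx p \<longleftrightarrow> (\<forall>M. \<exists>ys. length ys = degree p \<and> pvge M (p - lin_prod ys))"

text \<open>With \<open>b\<close> the inverse of \<open>a\<close>, this is the substitution of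
  \<open>(y - c) / a\<close>, which moves a root \<open>y\<close> to \<open>c + a * y\<close>; the
  power of \<open>a\<close> makes the result monic again.\<close>

lemma pcompose_lin_prod:
  fixes a b c :: "'b::comm_ring_1"
  assumes "a * b = 1"
  shows "smult (a ^ length ys) (pcompose (lin_prod ys) [:- (c * b), b:]) = lin_prod (map (\<lambda>y. c + a * y) ys)"
proof (induction ys)
  case (Cons y ys)
  have "smult a (pcompose [:- y, 1:] [:- (c * b), b:]) = [:- (c + a * y), 1:]"
    using assms mult.left_commute[of a c b] by (simp add: pcompose_pCons algebra_simps)
  then have "lin_prod (map (\<lambda>y. c + a * y) (y # ys)) =
      smult a (pcompose [:- y, 1:] [:- (c * b), b:]) * smult (a ^ length ys) (pcompose (lin_prod ys) [:- (c * b), b:])"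
    using Cons.IH by simp
  also have "\<dots> = smult (a ^ length (y # ys)) (pcompose (lin_prod (y # ys)) [:- (c * b), b:])"
    by (simp only: mult_smult_left mult_smult_right smult_smult pcompose_mult lin_prod_simps power_Suc list.size add_Suc_right add_0_right)
      (simp add: mult.commute)
  finally show ?case ..
qed (simp add: pcompose_1)

lemma splits_approx_affine:
  fixes p :: "'b::comm_ring_1 puiseux poly"
  assumes "splits_approx q" "degree q = degree p"
    and q: "q = smult (Poly_Mapping.single (- r) 1 ^ degree p) (pcompose p [:c, Poly_Mapping.single r 1:])"
  shows "splits_approx p"
  unfolding splits_approx_def
proof
  fix M
  let ?n = "degree p"
  let ?T = "Poly_Mapping.single r 1 :: 'b puiseux" and ?T' = "Poly_Mapping.single (- r) 1 :: 'b puiseux"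
  let ?l = "[:- (c * ?T'), ?T':]"
  have TT: "?T * ?T' = 1" by (simp add: mult_single)
  obtain L where L: "\<And>M q. degree q \<le> ?n \<Longrightarrow> pvge M q \<Longrightarrow> pvge (M - L) (pcompose q ?l)"
    using pvge_pcompose_loss[of ?n ?l] by blast
  \<comment> \<open>The precision pays in advance for the loss \<open>L\<close> of substituting back
    and for the shift of orders by \<open>?n * r\<close> caused by the factor
    \<open>?T ^ ?n\<close>.\<close>
  obtain ys where ys: "length ys = ?n" "pvge (M + L - of_nat ?n * r) (q - lin_prod ys)"
    using assms(1,2) unfolding splits_approx_def by metis
  have "pcompose [:c, ?T:] ?l = [:0, 1:]" using TT by (simp add: pcompose_pCons algebra_simps)
  then have "pcompose q ?l = smult (?T' ^ ?n) p"
    unfolding q by (simp add: pcompose_smult flip: pcompose_assoc)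
  then have "smult (?T ^ ?n) (pcompose q ?l) = p"
    using TT by (simp flip: power_mult_distrib)
  then have eq: "p - lin_prod (map (\<lambda>y. c + ?T * y) ys) = smult (?T ^ ?n) (pcompose (q - lin_prod ys) ?l)"
    using pcompose_lin_prod[OF TT, of ys c] ys(1) by (simp add: pcompose_diff smult_diff_right)
  have "degree (lin_prod ys) = ?n" using ys(1) by (simp add: lin_prod_def degree_linear_factors[of uminus])
  then have "degree (q - lin_prod ys) \<le> ?n" using assms(2) by (simp add: degree_diff_le)
  from L[OF this ys(2)] have "pvge (of_nat ?n * r + (M + L - of_nat ?n * r - L)) (p - lin_prod (map (\<lambda>y. c + ?T * y) ys))"
    unfolding eq by (intro pvge_smult) (auto simp: single_power)
  then show "\<exists>ys. length ys = ?n \<and> pvge M (p - lin_prod ys)"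
    using ys(1) by (intro exI[of _ "map (\<lambda>y. c + ?T * y) ys"]) auto
qed

lemma splits_approx_mult:
  fixes p G H :: "'b::comm_ring_1 puiseux poly"
  assumes "\<And>M. \<exists>G H. splits_approx G \<and> splits_approx H \<and> degree G + degree H = degree p \<and>
    pvge 0 G \<and> pvge 0 H \<and> pvge M (p - G * H)"
  shows "splits_approx p"
  unfolding splits_approx_def
proof
  fix M :: rat
  \<comment> \<open>At precision at least 0 the approximation of \<open>H\<close> inherits
    nonnegative orders, so that multiplying by it does not lose precision.\<close>
  let ?N = "max M 0"
  obtain G H where GH: "splits_approx G" "splits_approx H" "degree G + degree H = degree p"
    "pvge 0 G" "pvge 0 H" "pvge ?N (p - G * H)" using assms by metis
  obtain ys zs where y: "length ys = degree G" "pvge ?N (G - lin_prod ys)"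
    and z: "length zs = degree H" "pvge ?N (H - lin_prod zs)"
    using GH(1,2) unfolding splits_approx_def by metis
  have "pvge 0 (H - (H - lin_prod zs))" using pvge_mono[OF z(2), of 0] by (rule pvge_diff[OF GH(5)]) simp
  then have zi: "pvge 0 (lin_prod zs)" by simp
  have eq: "p - lin_prod (ys @ zs) = (p - G * H) + G * (H - lin_prod zs) + (G - lin_prod ys) * lin_prod zs"
    by (simp add: algebra_simps)
  moreover have "pvge (0 + ?N) (G * (H - lin_prod zs))" "pvge (?N + 0) ((G - lin_prod ys) * lin_prod zs)"
    using y z GH zi by (auto intro!: pvge_mult simp del: add_0_left add_0_right add_0)
  ultimately have "pvge ?N (p - lin_prod (ys @ zs))" unfolding eq using GH(6) by (intro pvge_add) simp_all
  then show "\<exists>ys. length ys = degree p \<and> pvge M (p - lin_prod ys)"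
    using y z GH(3) by (intro exI[of _ "ys @ zs"]) (auto elim: pvge_mono)
qed

text \<open>Write \<open>h = c + (Y - z) k\<close> with the nonzero constant
  \<open>c = h(z)\<close>. Modulo \<open>h\<close>, the unit \<open>c ^ m\<close> equals
  \<open>(- (Y - z) k) ^ m\<close>, a multiple of \<open>(Y - z) ^ m\<close>; dividing by
  \<open>c ^ m\<close> gives the identity.\<close>

lemma bezout_linear_power:
  fixes h :: "'a::field poly"
  assumes "poly h z \<noteq> 0"
  shows "\<exists>u w. u * h + w * [:- z, 1:] ^ m = 1"
proof -
  let ?c = "[:poly h z:]"
  have "[:- z, 1:] dvd h - ?c" by (simp add: poly_eq_0_iff_dvd[symmetric])
  then obtain k where k: "h - ?c = [:- z, 1:] * k" by blast
  have "?c - (- ([:- z, 1:] * k)) dvd ?c ^ m - (- ([:- z, 1:] * k)) ^ m"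
    unfolding power_diff_sumr2 by (rule dvd_triv_left)
  moreover have "?c - (- ([:- z, 1:] * k)) = h" using k by (simp add: algebra_simps)
  ultimately obtain v where v: "?c ^ m - (- ([:- z, 1:] * k)) ^ m = h * v" by (metis dvdE)
  have c: "?c ^ m = h * v + [:- z, 1:] ^ m * (- k) ^ m"
  proof -
    have "?c ^ m = h * v + (- ([:- z, 1:] * k)) ^ m" by (simp only: v[symmetric] diff_add_cancel)
    then show ?thesis by (simp only: mult_minus_right[symmetric] power_mult_distrib)
  qed
  let ?d = "[:inverse (poly h z) ^ m:]"
  have "?d * ?c ^ m = 1" using assms by (simp add: poly_const_pow flip: power_mult_distrib)
  then have "(?d * v) * h + (?d * (- k) ^ m) * [:- z, 1:] ^ m = 1"
    unfolding c by (simp add: algebra_simps)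
  then show ?thesis by blast
qed

text \<open>This is behind the Tschirnhaus shift: \<open>c = - coeff p n / (n + 1)\<close>,
  available in characteristic 0, removes the second coefficient.\<close>

lemma coeff_pcompose_shift:
  fixes p :: "'b::comm_ring_1 poly"
  assumes "degree p = Suc n" "monic p"
  shows "coeff (pcompose p [:c, 1:]) n = coeff p n + of_nat (Suc n) * c"
proof -
  have "degree (map_poly (\<lambda>x. [:x:]) p) = degree p" by (rule degree_map_poly) simp
  then have "pcompose p [:c, 1:] = (\<Sum>i\<le>Suc n. smult (coeff p i) ([:c, 1:] ^ i))"
    by (simp add: pcompose_altdef poly_altdef assms(1) coeff_map_poly del: sum.atMost_Suc)
  then have "coeff (pcompose p [:c, 1:]) n = (\<Sum>i\<le>Suc n. coeff p i * coeff ([:c, 1:] ^ i) n)"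
    by (simp add: coeff_sum del: sum.atMost_Suc)
  also have "\<dots> = (\<Sum>i\<in>{n, Suc n}. coeff p i * coeff ([:c, 1:] ^ i) n)"
    by (rule sum.mono_neutral_right) (auto simp: coeff_eq_0 degree_linear_power le_Suc_eq)
  also have "\<dots> = coeff p n + of_nat (Suc n) * c"
    using assms coeff_linear_poly_power[of n "Suc n" c 1]
    by (simp add: coeff_linear_power del: power_Suc)
  finally show ?thesis .
qed

text \<open>The number \<open>r\<close> below is the first slope of the Newton polygon, so that the rescaled
  polynomial has a residue other than \<open>Y ^ Suc n\<close>.  Since the second coefficient vanishes and the
  characteristic is 0, that residue is not a power of a linear polynomial either, and Hensel lifting
  applies.\<close>

lemma newton_puiseux_centered:
  fixes p :: "'a::{alg_closed_field, field_char_0} puiseux poly"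
  assumes IH: "\<And>q :: 'a puiseux poly. monic q \<Longrightarrow> degree q \<le> n \<Longrightarrow> splits_approx q"
    and p: "monic p" "degree p = Suc n" "coeff p n = 0"
  shows "splits_approx p"
proof (cases "\<forall>i\<le>n. coeff p i = 0")
  case True
  have "coeff p i = coeff (monom 1 (Suc n)) i" for i
    using True p by (cases "i \<le> n"; cases "i = Suc n") (auto simp: coeff_eq_0)
  then have "p = monom 1 (Suc n)" by (rule poly_eqI)
  moreover have "lin_prod (replicate k (0 :: 'a puiseux)) = monom 1 k" for k
    by (induction k) (auto simp: monom_Suc)
  ultimately have "p - lin_prod (replicate (Suc n) 0) = 0" by (simp only: diff_self)
  then show ?thesis unfolding splits_approx_def p(2) by (metis length_replicate pvge_0)
next
  case False
  define I where "I = {i. i \<le> n \<and> coeff p i \<noteq> 0}"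
  \<comment> \<open>Rescaling by \<open>t ^ r\<close> changes the order of coefficient
    \<open>i\<close> by \<open>- (Suc n - i) * r\<close>. So \<open>s i\<close> is the value of
    \<open>r\<close> that brings this coefficient to order 0, and the minimum of these keeps all
    orders nonnegative.\<close>
  define s where "s i = ord_t (coeff p i) / of_nat (Suc n - i)" for i
  define r where "r = Min (s ` I)"
  have I: "finite I" "I \<noteq> {}" using False by (auto simp: I_def)
  have sr: "r \<le> s i" if "i \<in> I" for i unfolding r_def using I that by simp
  have "r \<in> s ` I" unfolding r_def using I by (intro Min_in) auto
  then obtain j where j: "j \<in> I" "r = s j" by auto
  define q where "q = smult (Poly_Mapping.single (- r) 1 ^ degree p) (pcompose p [:0, Poly_Mapping.single r 1:])"
  have cq: "coeff q i = Poly_Mapping.single (- (of_nat (Suc n) - of_nat i) * r) 1 * coeff p i" for i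
    unfolding q_def coeff_smult coeff_pcompose_linear single_power p(2)
    by (simp add: mult_single flip: mult.assoc) (simp add: algebra_simps)
  have cqn: "coeff q (Suc n) = 1" using p by (simp add: cq)
  have "coeff q i = 0" if "i > Suc n" for i
    using that p by (simp add: cq coeff_eq_0)
  then have dq: "degree q = Suc n" using cqn by (intro antisym le_degree degree_le) auto
  have vq: "vge 0 (coeff q i)" if "i \<in> I" for i
  proof -
    have "r * (of_nat (Suc n) - of_nat i) \<le> ord_t (coeff p i)"
      using sr[OF that] that by (simp add: s_def I_def pos_le_divide_eq of_nat_diff)
    moreover have "vge (- (of_nat (Suc n) - of_nat i) * r + ord_t (coeff p i)) (coeff q i)"
      unfolding cq using that by (intro vge_mult ord_t_nonzero) (auto simp: I_def)
    ultimately show ?thesis by (elim vge_mono) (simp add: algebra_simps)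
  qed
  have q_int: "pvge 0 q" unfolding pvge_def
  proof
    fix i
    consider "i \<in> I" | "i = Suc n" | "coeff p i = 0"
      using p(2) by (cases i "Suc n" rule: linorder_cases) (auto simp: I_def coeff_eq_0)
    then show "vge 0 (coeff q i)"
      by cases (auto simp: vq cqn, simp add: cq)
  qed
  define \<rho> where "\<rho> = map_poly (\<lambda>c. lookup c 0) q"
  have c\<rho>: "coeff \<rho> i = lookup (coeff q i) 0" for i by (simp add: \<rho>_def coeff_map_poly)
  have d\<rho>: "degree \<rho> = Suc n" unfolding \<rho>_def using cqn dq by (subst map_poly_degree_eq) auto
  have m\<rho>: "monic \<rho>" using cqn by (simp add: d\<rho> c\<rho>)
  have \<rho>n: "coeff \<rho> n = 0" by (simp add: c\<rho> cq p(3))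
  have \<rho>j: "coeff \<rho> j \<noteq> 0" "j \<le> n"
  proof -
    have e: "- (of_nat (Suc n) - of_nat j) * r + ord_t (coeff p j) = 0"
      using j by (simp add: s_def I_def field_simps of_nat_diff)
    have "lookup (coeff q j) (- (of_nat (Suc n) - of_nat j) * r + ord_t (coeff p j)) = lookup (coeff p j) (ord_t (coeff p j))"
      unfolding cq using j(1) by (subst lookup_mult_lowest) (auto simp: I_def ord_t_nonzero)
    then have "coeff \<rho> j = lookup (coeff p j) (ord_t (coeff p j))" unfolding e c\<rho> .
    then show "coeff \<rho> j \<noteq> 0" "j \<le> n" using j(1) ord_t_nonzero(2)[of "coeff p j"]
      by (simp_all add: I_def)
  qed
  obtain z where z: "poly \<rho> z = 0" using alg_closed_imp_poly_has_root[of \<rho>] d\<rho> by auto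
  have \<rho>0: "\<rho> \<noteq> 0" using d\<rho> by auto
  \<comment> \<open>The full multiplicity of \<open>z\<close> goes into one factor, which makes the
    two factors coprime.\<close>
  define m where "m = order z \<rho>"
  from order_decomp[OF \<rho>0, of z, folded m_def]
  obtain h where h: "\<rho> = [:- z, 1:] ^ m * h" "\<not> [:- z, 1:] dvd h" by blast
  have m0: "m > 0" unfolding m_def using z \<rho>0 order_root[of \<rho> z] by auto
  have "lead_coeff \<rho> = lead_coeff h"
    unfolding h(1) by (simp add: lead_coeff_mult lead_coeff_power)
  then have hm: "monic h" using m\<rho> by simp
  have hz: "poly h z \<noteq> 0" using h(2) by (simp add: poly_eq_0_iff_dvd)
  have dh: "degree \<rho> = m + degree h"
    unfolding h(1) using hm by (subst degree_mult_eq) (auto simp: degree_linear_power)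
  have "degree h > 0"
  proof (rule ccontr)
    assume "\<not> degree h > 0"
    then have "h = 1" using hm monic_degree_0 by blast
    then have eq: "\<rho> = [:- z, 1:] ^ Suc n" using h(1) dh d\<rho> by simp
    then have "of_nat (Suc n) * (- z) = 0"
      using \<rho>n coeff_linear_poly_power[of n "Suc n" "- z" 1] by (simp del: power_Suc)
    then have "z = 0" by (simp del: of_nat_Suc)
    then have "\<rho> = monom 1 (Suc n)" using eq by (simp add: monom_altdef)
    then show False using \<rho>j by simp
  qed
  obtain u w where bez: "u * h + w * [:- z, 1:] ^ m = 1" using bezout_linear_power[OF hz] by blast
  have "splits_approx q"
  proof (rule splits_approx_mult)
    fix M
    have g: "monic ([:- z, 1:] ^ m)" by (rule monic_power) simp
    have dg: "degree ([:- z, 1:] ^ m) = m" by (rule degree_linear_power)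
    have "monic q" by (simp only: dq cqn)
    moreover have "map_poly (\<lambda>c. lookup c 0) q = [:- z, 1:] ^ m * h" by (simp only: h(1)[symmetric] \<rho>_def)
    moreover have "degree ([:- z, 1:] ^ m) > 0" by (simp only: dg m0)
    ultimately obtain G H where GH: "monic G" "monic H" "degree G = m" "degree H = degree h"
      "pvge 0 G" "pvge 0 H" "pvge M (q - G * H)"
      using hensel_approx[OF _ q_int _ bez g hm _ \<open>degree h > 0\<close>, of M] unfolding dg by blast
    moreover have "degree G \<le> n" "degree H \<le> n" "degree G + degree H = degree q"
      using GH(3,4) dh d\<rho> dq m0 \<open>degree h > 0\<close> by linarith+
    moreover have "splits_approx G" "splits_approx H"
      using GH(1,2) \<open>degree G \<le> n\<close> \<open>degree H \<le> n\<close> by (blast intro: IH)+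
    ultimately show "\<exists>G H. splits_approx G \<and> splits_approx H \<and> degree G + degree H = degree q \<and>
      pvge 0 G \<and> pvge 0 H \<and> pvge M (q - G * H)" by blast
  qed
  from splits_approx_affine[OF this _ q_def] show ?thesis by (simp add: dq p(2))
qed

theorem newton_puiseux_approx:
  fixes p :: "'a::{alg_closed_field, field_char_0} puiseux poly"
  assumes "monic p"
  shows "splits_approx p"
  using assms
proof (induction "degree p" arbitrary: p rule: less_induct)
  case less
  show ?case
  proof (cases "degree p")
    case 0
    then have "p = 1" using less.prems monic_degree_0 by blast
    then show ?thesis unfolding splits_approx_def by (intro allI exI[of _ "[]"]) simp
  next
    case (Suc n)
    define c where "c = - (Poly_Mapping.single 0 (1 / of_nat (Suc n)) * coeff p n)"
    define q where "q = pcompose p [:c, 1:]"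
    have dq: "degree q = Suc n" using Suc by (simp add: q_def)
    have mq: "monic q" using less.prems unfolding q_def by (subst lead_coeff_comp) auto
    have "(of_nat (Suc n) :: 'a puiseux) * Poly_Mapping.single 0 (1 / of_nat (Suc n)) = 1"
      unfolding single_of_nat[symmetric] mult_single by (simp del: of_nat_Suc single_of_nat)
    then have "of_nat (Suc n) * c = - coeff p n"
      unfolding c_def by (simp add: mult.assoc[symmetric] del: of_nat_Suc)
    then have "coeff q n = 0"
      unfolding q_def by (subst coeff_pcompose_shift) (use Suc less.prems in \<open>auto simp del: of_nat_Suc\<close>)
    moreover have "splits_approx s" if "monic s" "degree s \<le> n" for s :: "'a puiseux poly"
      using less.hyps[OF _ that(1)] that(2) Suc by simp
    ultimately have "splits_approx q" using newton_puiseux_centered mq dq by blast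
    have "q = smult (Poly_Mapping.single (- 0) 1 ^ degree p) (pcompose p [:c, Poly_Mapping.single 0 1:])"
      by (simp add: q_def)
    from splits_approx_affine[OF \<open>splits_approx q\<close> _ this] show ?thesis by (simp only: dq Suc)
  qed
qed

section \<open>Resultants in terms of roots\<close>

text \<open>A kernel vector of the transpose lists the coefficients of a nonzero polynomial of
  degree below \<open>m\<close> with \<open>m\<close> distinct roots. Exponents descend to match the
  columns of the Sylvester matrix.\<close>

lemma det_vandermonde_nonzero:
  fixes ys :: "'b::idom list"
  assumes "distinct ys"
  defines "m \<equiv> length ys"
  shows "det (mat m m (\<lambda>(i, j). (ys ! j) ^ (m - 1 - i))) \<noteq> 0" (is "det ?V \<noteq> 0")
proof
  assume "det ?V = 0"
  then have "det (transpose_mat ?V) = 0" by (subst det_transpose[of _ m]) auto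
  then obtain v where v: "v \<in> carrier_vec m" "v \<noteq> 0\<^sub>v m" "transpose_mat ?V *\<^sub>v v = 0\<^sub>v m"
    by (subst (asm) det_0_iff_vec_prod_zero[of _ m]) auto
  define p where "p = (\<Sum>i<m. monom (v $ i) (m - 1 - i))"
  have "poly p (ys ! j) = 0" if "j < m" for j
  proof -
    have "(transpose_mat ?V *\<^sub>v v) $ j = 0" using v(3) that by simp
    moreover have "(transpose_mat ?V *\<^sub>v v) $ j = (\<Sum>i<m. (ys ! j) ^ (m - 1 - i) * v $ i)"
      using that v(1) by (simp add: scalar_prod_def lessThan_atLeast0)
    ultimately show ?thesis by (simp add: p_def poly_sum poly_monom mult.commute)
  qed
  then have roots: "set ys \<subseteq> {x. poly p x = 0}" by (auto simp: in_set_conv_nth m_def)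
  have ci: "coeff p (m - 1 - i) = v $ i" if "i < m" for i
  proof -
    have "coeff p (m - 1 - i) = (\<Sum>k<m. if k = i then v $ k else 0)"
      unfolding p_def coeff_sum using that by (intro sum.cong) (auto simp: coeff_monom)
    then show ?thesis using that by simp
  qed
  have "p = 0"
  proof (rule ccontr)
    assume "p \<noteq> 0"
    then have "card (set ys) \<le> card {x. poly p x = 0}" using roots by (intro card_mono poly_roots_finite)
    then have "m \<le> degree p" using card_poly_roots_bound[OF \<open>p \<noteq> 0\<close>] distinct_card[OF assms(1)] m_def by simp
    moreover have "degree p \<le> m - 1"
      unfolding p_def by (intro degree_sum_le) (auto intro: order.trans[OF degree_monom_le])
    ultimately have "m = 0" by linarith
    then show False using \<open>p \<noteq> 0\<close> p_def by simp
  qed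
  then have "v $ i = 0" if "i < m" for i using ci[OF that] by simp
  then have "v = 0\<^sub>v m" using v(1) by (intro eq_vecI) auto
  then show False using v(2) by simp
qed

lemma poly_rev_sum:
  fixes p :: "'b::comm_semiring_1 poly"
  assumes "degree p < N"
  shows "poly p x = (\<Sum>k<N. coeff p (N - 1 - k) * x ^ (N - 1 - k))"
proof -
  have "poly p x = (\<Sum>k<N. coeff p k * x ^ k)"
    unfolding poly_altdef using assms by (intro sum.mono_neutral_left) (auto simp: coeff_eq_0)
  also have "\<dots> = (\<Sum>k<N. coeff p (N - 1 - k) * x ^ (N - 1 - k))"
    by (rule sum.reindex_bij_witness[of _ "\<lambda>k. N - 1 - k" "\<lambda>k. N - 1 - k"]) auto
  finally show ?thesis .
qed

lemma degree_lin_prod [simp]: "degree (lin_prod ys) = length (ys :: 'b::idom list)"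
  by (simp add: lin_prod_def degree_linear_factors[of uminus])

lemma monic_lin_prod: "monic (lin_prod (ys :: 'b::idom list))"
  unfolding lin_prod_def by (rule monic_prod_list) auto

lemma poly_lin_prod: "poly (lin_prod ys) x = (\<Prod>y\<leftarrow>ys. x - y)"
  by (induction ys) (auto simp: algebra_simps)

lemma sylvester_row:
  fixes p q :: "'b::comm_ring_1 poly"
  assumes "i < degree p + degree q" "j < degree p + degree q"
  shows "sylvester_mat p q $$ (i, j) = coeff (if i < degree q then monom 1 (degree q - 1 - i) * p
    else monom 1 (degree p + degree q - 1 - i) * q) (degree p + degree q - 1 - j)"
  using assms by (subst sylvester_index_mat) (auto simp: coeff_monom_mult coeff_eq_0 intro!: arg_cong[of _ _ "coeff _"])

text \<open>Multiplying the Sylvester matrix on the right by \<open>?P\<close> evaluates its rows at the roots.\<close>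

lemma resultant_lin_prod_distinct:
  fixes ys :: "'b::idom list"
  assumes ys: "distinct ys"
  shows "resultant (lin_prod ys) h = (\<Prod>y\<leftarrow>ys. poly h y)"
proof -
  define m n g where "m = length ys" and "n = degree h" and "g = lin_prod ys"
  have dg: "degree g = m" "monic g" unfolding g_def m_def using monic_lin_prod by auto
  define S where "S = sylvester_mat g h"
  let ?N = "n + m"
  have S: "S \<in> carrier_mat ?N ?N" unfolding S_def using sylvester_carrier_mat[of g h] dg n_def by (simp add: add.commute)
  let ?V = "mat m m (\<lambda>(i, j). (ys ! j) ^ (m - 1 - i))"
  let ?W = "mat n m (\<lambda>(i, j). (ys ! j) ^ (?N - 1 - i))"
  let ?D = "mat m m (\<lambda>(i, j). if i = j then poly h (ys ! j) else 0)"
  let ?A = "mat n n (\<lambda>(i, j). S $$ (i, j))"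
  let ?C = "mat m n (\<lambda>(i, j). S $$ (n + i, j))"
  let ?P = "four_block_mat (1\<^sub>m n) ?W (0\<^sub>m m n) ?V"
  have P: "?P \<in> carrier_mat ?N ?N" by auto
  have row: "S $$ (i, j) = coeff (if i < n then monom 1 (n - 1 - i) * g
    else monom 1 (?N - 1 - i) * h) (?N - 1 - j)" if "i < ?N" "j < ?N" for i j
    unfolding S_def using that by (subst sylvester_row) (simp_all add: dg n_def add.commute)
  have deg: "degree (if i < n then monom 1 (n - 1 - i) * g else monom 1 (?N - 1 - i) * h) < ?N"
    if "i < ?N" for i
    using that dg(1) n_def degree_mult_le[of "monom 1 (n - 1 - i)" g] degree_mult_le[of "monom 1 (?N - 1 - i)" h]
    by (auto simp: degree_monom_eq)
  have key: "(\<Sum>k<?N. S $$ (i, k) * y ^ (?N - 1 - k)) = (if i < n then 0 else y ^ (?N - 1 - i) * poly h y)"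
    if "i < ?N" "y \<in> set ys" for i y
  proof -
    have "poly g y = 0" using that(2) by (auto simp: g_def poly_lin_prod prod_list_zero_iff)
    moreover have "(\<Sum>k<?N. S $$ (i, k) * y ^ (?N - 1 - k)) = poly (if i < n then monom 1 (n - 1 - i) * g
    else monom 1 (?N - 1 - i) * h) y"
      unfolding poly_rev_sum[OF deg[OF that(1)]] using row[OF that(1)] by simp
    ultimately show ?thesis by (simp add: poly_monom)
  qed
  define E where "E = ?V * ?D"
  have E: "E \<in> carrier_mat m m" unfolding E_def by (intro mult_carrier_mat[of _ m m]) auto
  have E_index: "E $$ (i', j') = (ys ! j') ^ (m - 1 - i') * poly h (ys ! j')" if "i' < m" "j' < m" for i' j'
    unfolding E_def using that by (simp add: scalar_prod_def if_distrib sum.delta cong: if_cong)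
  \<comment> \<open>The rows of \<open>g\<close> vanish at the roots of \<open>g\<close>, and those
    of \<open>h\<close> become multiples of the values of \<open>h\<close>. The product is therefore
    block triangular, and \<open>det ?V\<close> appears on both sides; it can be cancelled because
    the roots are distinct.\<close>
  have "S * ?P = four_block_mat ?A (0\<^sub>m n m) ?C E" (is "_ = ?R")
  proof (rule eq_matI)
    fix i j assume "i < dim_row ?R" "j < dim_col ?R"
    then have ij: "i < ?N" "j < ?N" using E by auto
    have Pk: "?P $$ (k, j) = (if j < n then if k = j then 1 else 0 else (ys ! (j - n)) ^ (?N - 1 - k))" if "k < ?N" for k
      using that ij by (auto simp: four_block_mat_def ac_simps)
    have "(S * ?P) $$ (i, j) = (\<Sum>k<?N. S $$ (i, k) * ?P $$ (k, j))"
      using S P ij by (simp add: scalar_prod_def lessThan_atLeast0)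
    also have "\<dots> = (\<Sum>k<?N. S $$ (i, k) * (if j < n then if k = j then 1 else 0 else (ys ! (j - n)) ^ (?N - 1 - k)))"
      by (intro sum.cong refl) (simp only: Pk lessThan_iff)
    also have "\<dots> = (if j < n then S $$ (i, j) else if i < n then 0 else (ys ! (j - n)) ^ (?N - 1 - i) * poly h (ys ! (j - n)))"
    proof (cases "j < n")
      case False
      then have "ys ! (j - n) \<in> set ys" using ij by (auto simp: m_def intro!: nth_mem)
      from key[OF ij(1) this] False show ?thesis by (simp only: if_False)
    qed (use ij in \<open>simp add: if_distrib[of "(*) (S $$ (i, k))" for k] cong: if_cong\<close>)
    also have "\<dots> = ?R $$ (i, j)"
      using ij E by (auto simp: four_block_mat_def E_index ac_simps)
    finally show "(S * ?P) $$ (i, j) = ?R $$ (i, j)" .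
  qed (use S E in auto)
  then have "det S * det ?P = det ?R" using det_mult[OF S P] by simp
  moreover have "det ?P = det ?V"
    by (subst det_four_block_mat_lower_left_zero[of _ n _ m]) auto
  moreover have "det ?R = det ?A * det E"
    using E by (subst det_four_block_mat_upper_right_zero[of _ n _ m]) auto
  moreover have "det E = det ?V * det ?D" unfolding E_def by (rule det_mult[of _ m]) auto
  moreover have "det ?A = 1"
  proof -
    have "upper_triangular ?A" unfolding upper_triangular_def
    proof (intro allI impI)
      fix i j assume "i < dim_row ?A" "j < i"
      then show "?A $$ (i, j) = 0" using dg(1) row[of i j] by (auto simp: coeff_monom_mult coeff_eq_0)
    qed
    then have "det ?A = prod_list (diag_mat ?A)" by (intro det_upper_triangular[of _ n]) auto
    also have "\<dots> = (\<Prod>i<n. ?A $$ (i, i))" by (simp add: prod_list_diag_prod lessThan_atLeast0)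
    also have "\<dots> = (\<Prod>i<n. 1)" using dg row by (intro prod.cong) (auto simp: coeff_monom_mult)
    finally show ?thesis by simp
  qed
  moreover have "det ?D = (\<Prod>y\<leftarrow>ys. poly h y)"
  proof -
    have "det ?D = prod_list (diag_mat ?D)" by (intro det_upper_triangular[of _ m]) (auto simp: upper_triangular_def)
    also have "diag_mat ?D = map (poly h) ys" by (auto simp: diag_mat_def m_def intro!: nth_equalityI)
    finally show ?thesis .
  qed
  moreover have "det ?V \<noteq> 0" using det_vandermonde_nonzero[OF ys] by (simp add: m_def)
  ultimately show ?thesis by (simp add: resultant_def S_def g_def)
qed

lemma (in comm_ring_hom) map_poly_lin_prod: "map_poly hom (lin_prod ys) = lin_prod (map hom ys)"
proof -
  interpret mp: map_poly_comm_ring_hom hom ..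
  show ?thesis by (induction ys) (simp_all add: mp.hom_mult hom_distribs del: mult_pCons_left)
qed

text \<open>The roots are made distinct by an additional indeterminate, which is then set to 0.\<close>

theorem resultant_lin_prod:
  fixes ys :: "'b::idom list"
  shows "resultant (lin_prod ys) h = (\<Prod>y\<leftarrow>ys. poly h y)"
proof -
  \<comment> \<open>Different exponents separate equal roots; they start at 1, so that setting the
    indeterminate to 0 restores \<open>ys\<close>.\<close>
  define zs where "zs = map (\<lambda>i. [:ys ! i:] + monom 1 (Suc i)) [0..<length ys]"
  let ?h = "map_poly (\<lambda>c. [:c:]) h"
  have "distinct zs" unfolding zs_def distinct_map
  proof (intro conjI inj_onI)
    fix i j assume "[:ys ! i:] + monom 1 (Suc i) = [:ys ! j:] + monom 1 (Suc j)"
    from arg_cong[OF this, of "\<lambda>p. coeff p (Suc i)"] show "i = j" by (simp split: if_splits)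
  qed simp
  then have "resultant (lin_prod zs) ?h = (\<Prod>z\<leftarrow>zs. poly ?h z)" by (rule resultant_lin_prod_distinct)
  then have "poly (resultant (lin_prod zs) ?h) 0 = (\<Prod>z\<leftarrow>zs. poly (poly ?h z) 0)"
    by (simp add: poly_hom.hom_prod_list comp_def)
  moreover have ev: "map (\<lambda>z. poly z 0) zs = ys" by (auto simp: zs_def poly_monom intro!: nth_equalityI)
  moreover have "degree ?h = degree h" by (rule degree_map_poly) simp
  then have "poly (poly ?h z) 0 = poly h (poly z 0)" for z
    unfolding poly_altdef[of ?h] poly_altdef[of h] by (simp add: coeff_map_poly poly_sum)
  then have "map (\<lambda>z. poly (poly ?h z) 0) zs = map (poly h) (map (\<lambda>z. poly z 0) zs)" by simp
  ultimately have "poly (resultant (lin_prod zs) ?h) 0 = (\<Prod>y\<leftarrow>ys. poly h y)" by (simp only:)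
  moreover have g: "map_poly (\<lambda>p. poly p 0) (lin_prod zs) = lin_prod ys"
    by (simp only: poly_hom.map_poly_lin_prod ev)
  moreover have h: "map_poly (\<lambda>p. poly p 0) ?h = h"
    by (rule poly_eqI) (simp add: coeff_map_poly)
  moreover have "resultant (map_poly (\<lambda>p. poly p 0) (lin_prod zs)) (map_poly (\<lambda>p. poly p 0) ?h) =
      poly (resultant (lin_prod zs) ?h) 0"
    by (rule poly_hom.resultant_map_poly) (simp_all only: g h degree_lin_prod \<open>degree ?h = degree h\<close>, simp add: zs_def)
  ultimately show ?thesis by simp
qed

section \<open>Perturbation of resultants\<close>

text \<open>Factors are exchanged one at a time, and each of the others costs at most
  \<open>c\<close>, the bound on its pole order. The total loss is independent of
  \<open>M\<close>.\<close>

lemma prod_perturb: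
  fixes a b :: "_ \<Rightarrow> 'b::comm_ring_1 puiseux"
  assumes "finite I" "c \<ge> 0" "\<And>i. i \<in> I \<Longrightarrow> vge (- c) (a i)" "\<And>i. i \<in> I \<Longrightarrow> vge (- c) (b i)"
    "\<And>i. i \<in> I \<Longrightarrow> vge M (a i - b i)"
  shows "vge (M - of_nat (card I) * c) (prod a I - prod b I)"
  using assms(1,3-)
proof (induction I rule: finite_induct)
  case (insert x I)
  have eq: "prod a (insert x I) - prod b (insert x I) = a x * (prod a I - prod b I) + (a x - b x) * prod b I"
    using insert by (simp add: algebra_simps)
  have "vge (- c + (M - of_nat (card I) * c)) (a x * (prod a I - prod b I))"
    using insert by (intro vge_mult) auto
  moreover have "vge (M + (\<Sum>i\<in>I. - c)) ((a x - b x) * prod b I)"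
    using insert by (intro vge_mult vge_prod) auto
  moreover have "- c + (M - of_nat (card I) * c) \<le> M + (\<Sum>i\<in>I. - c)" using assms(2) by simp
  moreover have "M - of_nat (card (insert x I)) * c = - c + (M - of_nat (card I) * c)"
    using insert by (simp add: algebra_simps)
  ultimately show ?case unfolding eq by (auto intro!: vge_add elim: vge_mono)
qed simp

lemma det_perturb:
  fixes A B :: "'b::comm_ring_1 puiseux mat"
  assumes "A \<in> carrier_mat n n" "B \<in> carrier_mat n n" "c \<ge> 0"
    and "\<And>i j. i < n \<Longrightarrow> j < n \<Longrightarrow> vge (- c) (A $$ (i, j)) \<and> vge (- c) (B $$ (i, j)) \<and> vge M (A $$ (i, j) - B $$ (i, j))"
  shows "vge (M - of_nat n * c) (det A - det B)"
proof -
  have "det A - det B = (\<Sum>p | p permutes {0..<n}. signof p * ((\<Prod>i=0..<n. A $$ (i, p i)) - (\<Prod>i=0..<n. B $$ (i, p i))))"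
    using assms(1,2) by (simp add: det_def algebra_simps sum_subtractf)
  also have "vge (M - of_nat n * c) \<dots>"
  proof (rule vge_sum)
    fix p assume "p \<in> {p. p permutes {0..<n}}"
    then have p: "p i < n" if "i < n" for i using permutes_in_image[of p "{0..<n}" i] that by auto
    have "vge (M - of_nat (card {0..<n}) * c) ((\<Prod>i=0..<n. A $$ (i, p i)) - (\<Prod>i=0..<n. B $$ (i, p i)))"
      by (rule prod_perturb) (use assms p in auto)
    then show "vge (M - of_nat n * c) (signof p * ((\<Prod>i=0..<n. A $$ (i, p i)) - (\<Prod>i=0..<n. B $$ (i, p i))))"
      by (cases "evenperm p") (simp_all add: sign_def, metis minus_diff_eq vge_uminus)
  qed
  finally show ?thesis .
qed

lemma resultant_perturb:
  fixes p q :: "'b::comm_ring_1 puiseux poly"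
  assumes "degree p' = degree p" "degree q' = degree q" "c \<ge> 0"
    "pvge (- c) p" "pvge (- c) p'" "pvge (- c) q" "pvge (- c) q'" "pvge M (p - p')" "pvge M (q - q')"
  shows "vge (M - of_nat (degree p + degree q) * c) (resultant p q - resultant p' q')"
  unfolding resultant_def
proof (rule det_perturb)
  show "sylvester_mat p q \<in> carrier_mat (degree p + degree q) (degree p + degree q)"
    by (rule sylvester_carrier_mat)
  show "sylvester_mat p' q' \<in> carrier_mat (degree p + degree q) (degree p + degree q)"
    using sylvester_carrier_mat[of p' q'] assms(1,2) by simp
qed (use assms in \<open>auto simp: sylvester_index_mat pvge_def\<close>)

section \<open>The tree of a finite set of Puiseux sums\<close>

definition disc :: "'b::ab_group_add puiseux set \<Rightarrow> 'b puiseux \<times> rat \<Rightarrow> 'b puiseux set" where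
  "disc Y \<sigma> = {y \<in> Y. vge (snd \<sigma>) (y - fst \<sigma>)}"

text \<open>Two leaves above a node continue along the same branch iff their coefficients of
  \<open>t ^ \<delta>\<close> agree, so a branch is represented by that coefficient. These
  coefficients will be the roots of the leading polynomial in \<pi>.\<close>

definition branches :: "'b::ab_group_add puiseux set \<Rightarrow> 'b puiseux \<times> rat \<Rightarrow> 'b set" where
  "branches Y \<sigma> = (\<lambda>y. lookup y (snd \<sigma>)) ` disc Y \<sigma>"

definition is_node :: "'b::zero puiseux \<times> rat \<Rightarrow> bool" where
  "is_node \<sigma> \<longleftrightarrow> (\<forall>j\<in>keys (fst \<sigma>). j < snd \<sigma>)"

definition branch_nodes :: "'b::ab_group_add puiseux set \<Rightarrow> ('b puiseux \<times> rat) set" where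
  "branch_nodes Y = {\<sigma>. is_node \<sigma> \<and> card (branches Y \<sigma>) > 1}"

text \<open>The case distinction gives the minimum of \<open>\<delta>\<close> and the order of \<open>y - a\<close> also for \<open>y = a\<close>,
  where \<open>ord_t\<close> is unspecified.\<close>

definition contact :: "'b::ab_group_add puiseux \<times> rat \<Rightarrow> 'b puiseux \<Rightarrow> rat" where
  "contact \<sigma> y = (if vge (snd \<sigma>) (y - fst \<sigma>) then snd \<sigma> else ord_t (y - fst \<sigma>))"

definition trunc :: "rat \<Rightarrow> 'b::comm_monoid_add puiseux \<Rightarrow> 'b puiseux" where
  "trunc \<delta> z = (\<Sum>k\<in>{k \<in> keys z. k < \<delta>}. Poly_Mapping.single k (lookup z k))"

lemma lookup_trunc: "lookup (trunc \<delta> z) q = (if q < \<delta> then lookup z q else 0)"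
proof -
  have "finite {k \<in> keys z. k < \<delta>}" by simp
  then show ?thesis by (auto simp: trunc_def lookup_sum lookup_single when_def in_keys_iff)
qed

lemma is_node_trunc: "is_node (trunc \<delta> z, \<delta>)"
  by (auto simp: is_node_def in_keys_iff lookup_trunc split: if_splits)

lemma vge_minus_trunc: "vge \<delta> (z - trunc \<delta> z)" for z :: "'b::ab_group_add puiseux"
  by (auto simp: vge_def lookup_minus lookup_trunc not_less split: if_splits)

lemma vge_diff_swap: "vge r (f - g) \<longleftrightarrow> vge r (g - f)" for f g :: "'b::ab_group_add puiseux"
  using vge_uminus[of r "f - g"] by simp

lemma vge_diff_trans: "vge r (f - g) \<Longrightarrow> vge r (g - h) \<Longrightarrow> vge r (f - h)"
  for f g h :: "'b::ab_group_add puiseux"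
  using vge_add[of r "f - g" "g - h"] by simp

lemma ord_t_diff_swap: "ord_t (f - g) = ord_t (g - f)" for f g :: "'b::ab_group_add puiseux"
  using ord_t_uminus[of "f - g"] by simp

lemma lookup_eq_of_vge_diff: "vge r (f - g) \<Longrightarrow> q < r \<Longrightarrow> lookup f q = lookup g q"
  for f g :: "'b::ab_group_add puiseux"
  by (force simp: vge_def lookup_minus)

text \<open>A node is thus determined by \<delta> and any one leaf above it, so different pairs
  never describe the same point of the tree.\<close>

lemma node_eq_trunc:
  fixes z :: "'b::ab_group_add puiseux"
  assumes "is_node (a, \<delta>)" "vge \<delta> (z - a)"
  shows "a = trunc \<delta> z"
proof (rule poly_mapping_eqI)
  fix q
  show "lookup a q = lookup (trunc \<delta> z) q"
  proof (cases "q < \<delta>")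
    case True
    then show ?thesis using lookup_eq_of_vge_diff[OF assms(2)] by (simp add: lookup_trunc)
  next
    case False
    then show ?thesis using assms(1) by (auto simp: is_node_def in_keys_iff lookup_trunc)
  qed
qed

text \<open>The alternative with at most one branch is needed for the nodes that only
  \<open>z\<close> passes through, beyond the point where it leaves the tree: they gain a branch
  without becoming branch nodes.\<close>

lemma branches_insert_leaf:
  fixes Y :: "'b::ab_group_add puiseux set"
  assumes fin: "finite Y" "Y \<noteq> {}" and z: "z \<notin> Y"
  obtains \<sigma> where "is_node \<sigma>" "branches Y \<sigma> \<noteq> {}"
    "card (branches (insert z Y) \<sigma>) = Suc (card (branches Y \<sigma>))"
    "\<And>\<tau>. is_node \<tau> \<Longrightarrow> \<tau> \<noteq> \<sigma> \<Longrightarrow> branches (insert z Y) \<tau> = branches Y \<tau> \<or>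
      card (branches (insert z Y) \<tau>) \<le> 1 \<and> card (branches Y \<tau>) \<le> 1"
    "\<And>y. y \<in> Y \<Longrightarrow> contact \<sigma> y = ord_t (y - z)"
proof
  \<comment> \<open>The largest order to which \<open>z\<close> agrees with an old leaf. Below it
    \<open>z\<close> follows such a leaf \<open>w0\<close>, and at it the coefficient of
    \<open>z\<close> is new.\<close>
  define \<delta> where "\<delta> = Max ((\<lambda>w. ord_t (z - w)) ` Y)"
  have le: "ord_t (z - w) \<le> \<delta>" if "w \<in> Y" for w unfolding \<delta>_def using fin that by simp
  have "\<delta> \<in> (\<lambda>w. ord_t (z - w)) ` Y" unfolding \<delta>_def using fin by (intro Max_in) auto
  then obtain w0 where w0: "w0 \<in> Y" "ord_t (z - w0) = \<delta>" by blast
  have nz: "z - w \<noteq> 0" if "w \<in> Y" for w using z that by auto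
  let ?\<sigma> = "(trunc \<delta> z, \<delta>)"
  show "is_node ?\<sigma>" by (rule is_node_trunc)
  have disc: "w \<in> disc Y ?\<sigma> \<longleftrightarrow> w \<in> Y \<and> vge \<delta> (z - w)" for w
    unfolding disc_def using vge_minus_trunc[of \<delta> z] by (auto simp: vge_diff_swap intro: vge_diff_trans)
  have w0v: "vge \<delta> (z - w0)" using ord_t_nonzero(1)[OF nz[OF w0(1)]] w0(2) by simp
  then have "w0 \<in> disc Y ?\<sigma>" using disc w0 by blast
  then show "branches Y ?\<sigma> \<noteq> {}" by (auto simp: branches_def)
  have "disc (insert z Y) ?\<sigma> = insert z (disc Y ?\<sigma>)"
    using vge_minus_trunc[of \<delta> z] by (auto simp: disc_def)
  then have "branches (insert z Y) ?\<sigma> = insert (lookup z \<delta>) (branches Y ?\<sigma>)" by (simp add: branches_def)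
  moreover have "lookup z \<delta> \<notin> branches Y ?\<sigma>"
  proof
    assume "lookup z \<delta> \<in> branches Y ?\<sigma>"
    then obtain w where w: "w \<in> Y" "vge \<delta> (z - w)" "lookup z \<delta> = lookup w \<delta>"
      by (auto simp: branches_def disc)
    have "ord_t (z - w) = \<delta>" using le[OF w(1)] vge_ord_t[OF w(2) nz[OF w(1)]] by simp
    then show False using ord_t_nonzero(2)[OF nz[OF w(1)]] w(3) by (simp add: lookup_minus)
  qed
  moreover have "finite (branches Y ?\<sigma>)" using fin by (simp add: branches_def disc_def)
  ultimately show "card (branches (insert z Y) ?\<sigma>) = Suc (card (branches Y ?\<sigma>))" by simp
  show "branches (insert z Y) \<tau> = branches Y \<tau> \<or>
      card (branches (insert z Y) \<tau>) \<le> 1 \<and> card (branches Y \<tau>) \<le> 1" if \<tau>: "is_node \<tau>" "\<tau> \<noteq> ?\<sigma>" for \<tau>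
  proof -
    obtain a \<epsilon> where ae: "\<tau> = (a, \<epsilon>)" by (cases \<tau>)
    consider "\<not> vge \<epsilon> (z - a)" | "disc Y \<tau> = {}" "vge \<epsilon> (z - a)" | w where "w \<in> disc Y \<tau>" "vge \<epsilon> (z - a)" by blast
    then show ?thesis
    proof cases
      case 1
      then have "disc (insert z Y) \<tau> = disc Y \<tau>" by (auto simp: disc_def ae)
      then show ?thesis by (simp add: branches_def)
    next
      case 2
      then have "disc (insert z Y) \<tau> = {z}" by (auto simp: disc_def ae)
      then show ?thesis using 2 by (simp add: branches_def)
    next
      case 3
      then have w: "w \<in> Y" "vge \<epsilon> (w - a)" by (auto simp: disc_def ae)
      have "vge \<epsilon> (z - w)" using vge_diff_trans[OF 3(2), of w] w(2) by (simp add: vge_diff_swap)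
      then have "\<epsilon> \<le> \<delta>" using vge_ord_t[OF _ nz[OF w(1)]] le[OF w(1)] by force
      moreover have "\<epsilon> \<noteq> \<delta>" using \<tau> node_eq_trunc[of a \<epsilon> z] 3(2) by (auto simp: ae)
      ultimately have lt: "\<epsilon> < \<delta>" by simp
      then have "vge \<epsilon> (w0 - a)" using vge_diff_trans[of \<epsilon> w0 z a] vge_mono[OF w0v] 3(2)
        by (simp add: vge_diff_swap)
      then have "w0 \<in> disc Y \<tau>" using w0 by (simp add: disc_def ae)
      moreover have "lookup z \<epsilon> = lookup w0 \<epsilon>" using lookup_eq_of_vge_diff[OF w0v lt] .
      ultimately have "lookup z \<epsilon> \<in> branches Y \<tau>" by (auto simp: branches_def ae)
      moreover have "disc (insert z Y) \<tau> = insert z (disc Y \<tau>)" using 3(2) by (auto simp: disc_def ae)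
      ultimately show ?thesis by (auto simp: branches_def ae)
    qed
  qed
  show "contact ?\<sigma> y = ord_t (y - z)" if y: "y \<in> Y" for y
  proof (cases "vge \<delta> (y - trunc \<delta> z)")
    case True
    then have "vge \<delta> (z - y)" using disc[of y] y by (simp add: disc_def)
    then have "ord_t (z - y) = \<delta>" using le[OF y] vge_ord_t[OF _ nz[OF y]] by force
    then show ?thesis using True by (simp add: contact_def ord_t_diff_swap)
  next
    case False
    then have "\<not> vge \<delta> (z - y)" using disc[of y] y by (simp add: disc_def)
    then have lt: "ord_t (z - y) < \<delta>"
      using ord_t_nonzero(1)[OF nz[OF y]] by (meson not_less vge_mono)
    have "y - z \<noteq> 0" using nz[OF y] by auto
    moreover have "vgt (ord_t (y - z)) (z - trunc \<delta> z)"
      using vge_minus_trunc[of \<delta> z] lt by (intro vge_imp_vgt) (simp_all add: ord_t_diff_swap)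
    ultimately have "ord_t ((y - z) + (z - trunc \<delta> z)) = ord_t (y - z)" by (rule ord_t_add_higher(1))
    then show ?thesis using False by (simp add: contact_def)
  qed
qed

lemma branches_singleton: "card (branches {y} \<sigma>) \<le> 1"
proof -
  have "branches {y} \<sigma> \<subseteq> {lookup y (snd \<sigma>)}" by (auto simp: branches_def disc_def)
  from card_mono[OF _ this] show ?thesis by simp
qed

text \<open>The sum over branch nodes starts empty for a single leaf. The crude bound on the number
  of nodes is included because it does not depend on the precision of the leaves, which later yields
  finiteness of the set of split \<pi>-roots.\<close>

theorem branch_nodes_sum:
  fixes Y :: "'b::ab_group_add puiseux set"
  assumes "finite Y" "y \<in> Y"
  shows "finite (branch_nodes Y) \<and> card (branch_nodes Y) \<le> card Y \<and>
    (\<Sum>\<sigma>\<in>branch_nodes Y. (of_nat (card (branches Y \<sigma>)) - 1) * contact \<sigma> y) = (\<Sum>z\<in>Y - {y}. ord_t (y - z))"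
proof -
  have "finite (branch_nodes (insert y Z)) \<and> card (branch_nodes (insert y Z)) \<le> card (insert y Z) \<and>
    (\<Sum>\<sigma>\<in>branch_nodes (insert y Z). (of_nat (card (branches (insert y Z) \<sigma>)) - 1) * contact \<sigma> y) = (\<Sum>z\<in>Z. ord_t (y - z))"
    if "finite Z" "y \<notin> Z" for Z
    using that
  proof (induction Z rule: finite_induct)
    case empty
    have "branch_nodes {y} = {}" using branches_singleton[of y] by (auto simp: branch_nodes_def not_less)
    then show ?case by simp
  next
    case (insert z Z)
    let ?Y = "insert y Z" and ?Y' = "insert z (insert y Z)"
    let ?F = "\<lambda>Y \<sigma>. (of_nat (card (branches Y \<sigma>)) - 1) * contact \<sigma> y"
    have "finite ?Y" "?Y \<noteq> {}" "z \<notin> ?Y" using insert by auto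
    then obtain \<sigma> where \<sigma>: "is_node \<sigma>" "branches ?Y \<sigma> \<noteq> {}"
      "card (branches ?Y' \<sigma>) = Suc (card (branches ?Y \<sigma>))"
      "\<And>\<tau>. is_node \<tau> \<Longrightarrow> \<tau> \<noteq> \<sigma> \<Longrightarrow> branches ?Y' \<tau> = branches ?Y \<tau> \<or>
        card (branches ?Y' \<tau>) \<le> 1 \<and> card (branches ?Y \<tau>) \<le> 1"
      "\<And>y. y \<in> ?Y \<Longrightarrow> contact \<sigma> y = ord_t (y - z)"
      by (rule branches_insert_leaf) blast
    have IH: "finite (branch_nodes ?Y)" "card (branch_nodes ?Y) \<le> card ?Y"
      "(\<Sum>\<sigma>\<in>branch_nodes ?Y. ?F ?Y \<sigma>) = (\<Sum>z\<in>Z. ord_t (y - z))" using insert by auto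
    have "finite (branches ?Y \<sigma>)" using insert by (simp add: branches_def disc_def)
    then have c0: "card (branches ?Y \<sigma>) > 0" using \<sigma>(2) by (simp add: card_gt_0_iff)
    have same: "branches ?Y' \<tau> = branches ?Y \<tau>" if "\<tau> \<in> branch_nodes ?Y" "\<tau> \<noteq> \<sigma>" for \<tau>
      using \<sigma>(4)[of \<tau>] that by (auto simp: branch_nodes_def)
    have nodes: "branch_nodes ?Y' = insert \<sigma> (branch_nodes ?Y)"
    proof (rule Set.set_eqI)
      fix \<tau>
      show "\<tau> \<in> branch_nodes ?Y' \<longleftrightarrow> \<tau> \<in> insert \<sigma> (branch_nodes ?Y)"
      proof (cases "\<tau> = \<sigma>")
        case True
        then show ?thesis using c0 \<sigma>(1,3) by (simp add: branch_nodes_def)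
      next
        case False
        then show ?thesis using \<sigma>(4)[of \<tau>] by (auto simp: branch_nodes_def)
      qed
    qed
    have "(\<Sum>\<tau>\<in>branch_nodes ?Y'. ?F ?Y' \<tau>) = ?F ?Y' \<sigma> + (\<Sum>\<tau>\<in>branch_nodes ?Y - {\<sigma>}. ?F ?Y' \<tau>)"
      unfolding nodes using IH(1) by (simp add: sum.insert_remove)
    also have "(\<Sum>\<tau>\<in>branch_nodes ?Y - {\<sigma>}. ?F ?Y' \<tau>) = (\<Sum>\<tau>\<in>branch_nodes ?Y - {\<sigma>}. ?F ?Y \<tau>)"
      by (intro sum.cong refl) (simp add: same)
    also have "?F ?Y' \<sigma> = contact \<sigma> y + ?F ?Y \<sigma>" by (simp add: \<sigma>(3) algebra_simps)
    also have "contact \<sigma> y + ?F ?Y \<sigma> + (\<Sum>\<tau>\<in>branch_nodes ?Y - {\<sigma>}. ?F ?Y \<tau>) =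
        contact \<sigma> y + (\<Sum>\<tau>\<in>insert \<sigma> (branch_nodes ?Y). ?F ?Y \<tau>)"
      using IH(1) by (simp add: sum.insert_remove)
    \<comment> \<open>If \<sigma> was not a branch node before, it had exactly one branch, so its
      weight in the old tree is 0.\<close>
    also have "(\<Sum>\<tau>\<in>insert \<sigma> (branch_nodes ?Y). ?F ?Y \<tau>) = (\<Sum>\<tau>\<in>branch_nodes ?Y. ?F ?Y \<tau>)"
    proof (cases "\<sigma> \<in> branch_nodes ?Y")
      case False
      then have "card (branches ?Y \<sigma>) = 1" using \<sigma>(1) c0 by (simp add: branch_nodes_def)
      then show ?thesis using False IH(1) by simp
    qed (simp add: insert_absorb)
    finally have "(\<Sum>\<tau>\<in>branch_nodes ?Y'. ?F ?Y' \<tau>) = (\<Sum>w\<in>insert z Z. ord_t (y - w))"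
      using insert IH(3) \<sigma>(5)[of y] by simp
    moreover have "card (branch_nodes ?Y') \<le> card ?Y'"
      unfolding nodes using IH(1,2) insert by (auto simp: card_insert_if)
    moreover have "finite (branch_nodes ?Y')" unfolding nodes using IH(1) by simp
    ultimately show ?case by (simp only: insert_commute[of y z])
  qed
  from this[of "Y - {y}"] assms show ?thesis by (simp add: insert_absorb)
qed

section \<open>The substitution x = 1/t\<close>

declare coeff_lift_hom.hom_one [simp]

abbreviation poly_coeffs :: "'a::comm_ring_1 puiseux \<Rightarrow> 'a poly puiseux" where
  "poly_coeffs \<equiv> Poly_Mapping.map (\<lambda>c. [:c:])"

interpretation poly_coeffs_hom: comm_ring_hom "poly_coeffs :: 'a::comm_ring_1 puiseux \<Rightarrow> _"
  by (rule coeff_lift_hom.map_hom_comm_ring_hom)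

interpretation map_poly_coeffs_hom: map_poly_comm_ring_hom "poly_coeffs :: 'a::comm_ring_1 puiseux \<Rightarrow> _" ..

text \<open>The coefficients stay in the field, without \<pi>: the approximate roots are computed
  over this smaller ring, and \<open>subst_x\<close> factors through it.\<close>

definition subst_t :: "'a::comm_ring_1 poly \<Rightarrow> 'a puiseux" where
  "subst_t c = (\<Sum>k\<le>degree c. Poly_Mapping.single (- of_nat k) (coeff c k))"

lemma subst_t_altdef: "subst_t c = poly (map_poly (Poly_Mapping.single 0) c) (Poly_Mapping.single (- 1) 1)"
proof -
  have "degree (map_poly (Poly_Mapping.single 0 :: 'a \<Rightarrow> 'a puiseux) c) = degree c"
    by (rule single_hom.degree_map_poly_hom)
  then show ?thesis by (simp add: subst_t_def poly_altdef coeff_map_poly single_power mult_single)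
qed

lemma lookup_subst_t: "lookup (subst_t c) (- of_nat k) = coeff c k"
  by (auto simp: subst_t_def lookup_sum lookup_single when_def coeff_eq_0 if_distrib cong: if_cong)

lemma vge_subst_t: "vge (- of_nat (degree c)) (subst_t c)"
  unfolding subst_t_def by (intro vge_sum) auto

interpretation subst_t_hom: inj_comm_ring_hom "subst_t :: 'a::comm_ring_1 poly \<Rightarrow> _"
proof unfold_locales
  fix p q :: "'a poly"
  show "subst_t 0 = 0" "subst_t 1 = 1" "subst_t (p + q) = subst_t p + subst_t q" "subst_t (p * q) = subst_t p * subst_t q"
    by (simp_all add: subst_t_altdef single_poly_hom.hom_add single_poly_hom.hom_mult)
  assume "subst_t p = 0"
  then show "p = 0" by (intro poly_eqI) (metis lookup_subst_t coeff_0 lookup_zero)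
qed

interpretation map_subst_t_hom: map_poly_inj_comm_ring_hom "subst_t :: 'a::comm_ring_1 poly \<Rightarrow> _" ..

text \<open>Since \<open>x = 1/t\<close>, the top coefficient becomes the lowest term. This turns
  the degree in the intersection number into an order.\<close>

lemma ord_t_subst_t: "p \<noteq> 0 \<Longrightarrow> ord_t (subst_t p) = - of_nat (degree p)"
  by (rule ord_t_eqI[OF vge_subst_t]) (simp add: lookup_subst_t)

lemma subst_t_const: "subst_t [:c:] = Poly_Mapping.single 0 c"
  by (simp add: subst_t_def)

lemma subst_x_eq: "subst_x c = poly_coeffs (subst_t c)"
  by (simp add: subst_x_def subst_t_def tpow_def coeff_lift_hom.map_hom_sum coeff_lift_hom.map_hom_single)

lemma eval_at_eq: "eval_at h s = poly (map_poly poly_coeffs (map_poly subst_t h)) s"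
proof -
  have "map_poly subst_x h = map_poly poly_coeffs (map_poly subst_t h)"
    by (rule poly_eqI) (simp add: coeff_map_poly subst_x_eq)
  then show ?thesis by (simp add: eval_at_def)
qed

section \<open>Leading terms at a node\<close>

text \<open>The leading coefficient of \<open>\<sigma> - y\<close> as a polynomial in \<pi>: it is
  linear if \<open>y\<close> lies above the node and a nonzero constant otherwise.\<close>

definition lead_factor :: "'a::comm_ring_1 puiseux \<times> rat \<Rightarrow> 'a puiseux \<Rightarrow> 'a poly" where
  "lead_factor \<sigma> y = (if vge (snd \<sigma>) (y - fst \<sigma>) then [:- lookup y (snd \<sigma>), 1:]
     else [:lookup (fst \<sigma> - y) (ord_t (y - fst \<sigma>)):])"

lemma lead_factor:
  fixes y :: "'a::comm_ring_1 puiseux"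
  assumes "is_node \<sigma>"
  defines "s \<equiv> pi_expr (fst \<sigma>) (snd \<sigma>) - poly_coeffs y"
  shows "vge (contact \<sigma> y) s" "lookup s (contact \<sigma> y) = lead_factor \<sigma> y" "lead_factor \<sigma> y \<noteq> 0"
    "contact \<sigma> y \<le> snd \<sigma>"
proof -
  obtain a \<delta> where \<sigma>: "\<sigma> = (a, \<delta>)" by (cases \<sigma>)
  have s: "s = poly_coeffs (a - y) + Poly_Mapping.single \<delta> [:0, 1:]"
    by (simp add: s_def \<sigma> pi_expr_def tpow_def poly_coeffs_hom.hom_minus)
  have a: "lookup a \<delta> = 0" using assms(1) by (auto simp: is_node_def \<sigma> in_keys_iff)
  have "vge (contact \<sigma> y) s \<and> lookup s (contact \<sigma> y) = lead_factor \<sigma> y \<and> lead_factor \<sigma> y \<noteq> 0 \<and> contact \<sigma> y \<le> \<delta>"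
  proof (cases "vge \<delta> (y - a)")
    case True
    then have "vge \<delta> (poly_coeffs (a - y))" by (intro coeff_lift_hom.vge_map_hom) (simp add: vge_diff_swap)
    then have "vge \<delta> s" unfolding s by (intro vge_add) auto
    then show ?thesis using True a
      by (simp add: \<sigma> contact_def lead_factor_def s lookup_add coeff_lift_hom.lookup_map_hom lookup_minus)
  next
    case False
    then have nz: "y - a \<noteq> 0" by auto
    have lt: "ord_t (y - a) < \<delta>" using False ord_t_nonzero(1)[OF nz] by (meson not_less vge_mono)
    have "vge (ord_t (y - a)) (poly_coeffs (a - y))"
      using ord_t_nonzero(1)[OF nz] by (intro coeff_lift_hom.vge_map_hom) (simp add: vge_diff_swap)
    then have "vge (ord_t (y - a)) s" unfolding s using lt by (intro vge_add) auto
    moreover have "lookup (a - y) (ord_t (y - a)) \<noteq> 0"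
      using ord_t_nonzero(2)[OF nz] by (simp add: lookup_minus)
    ultimately show ?thesis using False lt
      by (simp add: \<sigma> contact_def lead_factor_def s lookup_add coeff_lift_hom.lookup_map_hom lookup_single when_def)
  qed
  then show "vge (contact \<sigma> y) s" "lookup s (contact \<sigma> y) = lead_factor \<sigma> y" "lead_factor \<sigma> y \<noteq> 0"
    "contact \<sigma> y \<le> snd \<sigma>" by (simp_all add: \<sigma>)
qed

lemma prod_lead_factor:
  fixes Y :: "'a::field puiseux set"
  assumes "finite Y"
  shows "n_roots (\<Prod>y\<in>Y. lead_factor \<sigma> y) = card (branches Y \<sigma>)"
    and "degree (\<Prod>y\<in>Y. lead_factor \<sigma> y) = card (disc Y \<sigma>)"
proof -
  have nz: "lead_factor \<sigma> y \<noteq> 0" for y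
  proof (cases "vge (snd \<sigma>) (y - fst \<sigma>)")
    case False
    then have "y - fst \<sigma> \<noteq> 0" by auto
    from ord_t_nonzero(2)[OF this] False show ?thesis by (auto simp: lead_factor_def lookup_minus)
  qed (simp add: lead_factor_def)
  have "poly (lead_factor \<sigma> y) z = 0 \<longleftrightarrow> vge (snd \<sigma>) (y - fst \<sigma>) \<and> z = lookup y (snd \<sigma>)" for y z
    using nz[of y] by (simp add: lead_factor_def eq_commute[of z] split: if_splits)
  then have "{z. poly (\<Prod>y\<in>Y. lead_factor \<sigma> y) z = 0} =
      {z. \<exists>y\<in>Y. vge (snd \<sigma>) (y - fst \<sigma>) \<and> z = lookup y (snd \<sigma>)}"
    using assms by (simp add: poly_prod prod_zero_iff)
  also have "\<dots> = branches Y \<sigma>" unfolding branches_def disc_def by blast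
  finally have "{z. poly (\<Prod>y\<in>Y. lead_factor \<sigma> y) z = 0} = branches Y \<sigma>" .
  then show "n_roots (\<Prod>y\<in>Y. lead_factor \<sigma> y) = card (branches Y \<sigma>)" by (simp add: n_roots_def)
  have "degree (\<Prod>y\<in>Y. lead_factor \<sigma> y) = (\<Sum>y\<in>Y. if vge (snd \<sigma>) (y - fst \<sigma>) then 1 else 0)"
    unfolding degree_prod_sum_eq[OF nz] by (intro sum.cong refl) (simp add: lead_factor_def)
  also have "\<dots> = card (disc Y \<sigma>)"
    unfolding disc_def card_eq_sum by (rule sum.inter_filter[symmetric, OF assms])
  finally show "degree (\<Prod>y\<in>Y. lead_factor \<sigma> y) = card (disc Y \<sigma>)" .
qed

lemma degree_linear_prod_set: "finite Y \<Longrightarrow> degree (\<Prod>y\<in>Y. [:- y, 1 :: 'b::idom:]) = card Y"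
  by (subst degree_prod_eq_sum_degree) auto

text \<open>At \<sigma> the product over \<open>Y\<close> has order at most
  \<open>card Y * \<delta>\<close>, because every contact is at most \<delta>. The remainder has
  order at least \<open>M - card Y * c\<close>, because \<sigma> has poles of order at most
  \<open>c\<close>. The bound on \<open>M\<close> separates the two.\<close>

lemma split_iff_branch_node:
  fixes h :: "'a::field poly poly" and Y :: "'a puiseux set"
  assumes Y: "finite Y" and node: "is_node \<sigma>"
    and h: "degree h \<le> card Y" "pvge M (map_poly subst_t h - (\<Prod>y\<in>Y. [:- y, 1:]))"
    and c: "c \<ge> 0" "vge (- c) (fst \<sigma>)" "- c \<le> snd \<sigma>"
    and M: "M > of_nat (card Y) * snd \<sigma> + of_nat (card Y) * c"
  shows "is_split_pi_root h \<sigma> \<longleftrightarrow> \<sigma> \<in> branch_nodes Y"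
    and "n_roots (lead_pi h \<sigma>) = card (branches Y \<sigma>)"
    and "lam h \<sigma> = (\<Sum>y\<in>Y. contact \<sigma> y)"
proof -
  let ?s = "pi_expr (fst \<sigma>) (snd \<sigma>)" and ?g = "\<Prod>y\<in>Y. [:- y, 1:]" and ?h = "map_poly subst_t h"
  let ?G = "\<Prod>y\<in>Y. ?s - poly_coeffs y" and ?l = "\<Sum>y\<in>Y. contact \<sigma> y"
  have "map_poly poly_coeffs [:- y, 1:] = [:- poly_coeffs y, 1:]" for y :: "'a puiseux"
    by (simp add: poly_coeffs_hom.hom_uminus)
  then have G: "poly (map_poly poly_coeffs ?g) ?s = ?G"
    by (simp add: map_poly_coeffs_hom.hom_prod poly_prod)
  have lookG: "lookup ?G ?l = (\<Prod>y\<in>Y. lead_factor \<sigma> y)"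
    using lead_factor[OF node] Y by (subst lookup_prod_lowest) auto
  moreover have "(\<Prod>y\<in>Y. lead_factor \<sigma> y) \<noteq> 0" using lead_factor(3)[OF node] Y by (simp add: prod_zero_iff)
  moreover have "vge ?l ?G" using lead_factor(1)[OF node] by (intro vge_prod)
  ultimately have ordG: "ord_t ?G = ?l" "?G \<noteq> 0" by (auto intro: ord_t_eqI)
  have sv: "vge (- c) ?s" unfolding pi_expr_def tpow_def
    using c by (intro vge_add coeff_lift_hom.vge_map_hom) auto
  have "pvge M (map_poly poly_coeffs (?h - ?g))"
    using h(2) by (auto simp: pvge_def coeff_map_poly intro: coeff_lift_hom.vge_map_hom)
  moreover have "degree (map_poly poly_coeffs (?h - ?g)) \<le> card Y"
  proof -
    have "degree ?h \<le> card Y" using degree_map_poly_le h(1) by (rule order.trans)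
    moreover have "degree ?g \<le> card Y" by (simp only: degree_linear_prod_set[OF Y])
    ultimately have "degree (?h - ?g) \<le> card Y" by (rule degree_diff_le)
    with degree_map_poly_le show ?thesis by (rule order.trans)
  qed
  ultimately have "vge (M - of_nat (card Y) * c) (poly (map_poly poly_coeffs (?h - ?g)) ?s)"
    using c sv by (intro pvge_eval)
  moreover have "?l \<le> of_nat (card Y) * snd \<sigma>"
    using sum_bounded_above[of Y "contact \<sigma>" "snd \<sigma>"] lead_factor(4)[OF node] by simp
  ultimately have "vgt (ord_t ?G) (poly (map_poly poly_coeffs (?h - ?g)) ?s)"
    using M ordG by (elim vge_imp_vgt) simp
  note hi = ord_t_add_higher[OF ordG(2) this]
  have ev: "eval_at h ?s = ?G + poly (map_poly poly_coeffs (?h - ?g)) ?s"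
    by (simp only: eval_at_eq map_poly_coeffs_hom.hom_minus poly_diff G) simp
  have e: "ord_t (eval_at h ?s) = ?l" "lookup (eval_at h ?s) ?l = (\<Prod>y\<in>Y. lead_factor \<sigma> y)" "eval_at h ?s \<noteq> 0"
    using hi unfolding ordG(1) lookG ev by blast+
  then have lead: "lead_pi h \<sigma> = (\<Prod>y\<in>Y. lead_factor \<sigma> y)" by (simp add: lead_pi_def Let_def)
  show "lam h \<sigma> = ?l" by (simp add: lam_def e)
  show n: "n_roots (lead_pi h \<sigma>) = card (branches Y \<sigma>)" by (simp add: lead prod_lead_factor[OF Y])
  have "finite (disc Y \<sigma>)" using Y by (simp add: disc_def)
  \<comment> \<open>More than one branch means a nonempty disc, hence a leading polynomial of
    positive degree, as a \<pi>-root requires.\<close>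
  then have "card (branches Y \<sigma>) \<le> card (disc Y \<sigma>)" unfolding branches_def by (rule card_image_le)
  then show "is_split_pi_root h \<sigma> \<longleftrightarrow> \<sigma> \<in> branch_nodes Y"
    using node e(3) unfolding is_split_pi_root_def is_pi_root_def branch_nodes_def n
    by (auto simp: is_node_def lead prod_lead_factor[OF Y])
qed

section \<open>Distinct approximate roots\<close>

text \<open>If \<open>y\<close> had order \<open>r < - c\<close>, then \<open>y ^ n\<close> would
  have order \<open>n * r\<close>, but all lower terms have order at least
  \<open>- c + (n - 1) * r\<close>, which is larger. The bound does not depend on the precision of
  the approximation.\<close>

lemma approx_root_bound:
  fixes y :: "'b::idom puiseux"
  assumes g: "monic g" "degree g = n" "pvge (- c) g" "c \<ge> 0" and y: "poly g y = 0"
  shows "vge (- c) y"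
proof (rule ccontr)
  assume neg: "\<not> vge (- c) y"
  then have y0: "y \<noteq> 0" by auto
  define r where "r = ord_t y"
  have r: "vge r y" "lookup y r \<noteq> 0" unfolding r_def using ord_t_nonzero[OF y0] by auto
  have rc: "r < - c" using neg vge_mono[OF r(1)] by (meson not_less)
  have "y ^ n = poly g y - (\<Sum>k<n. coeff g k * y ^ k)"
    by (simp add: poly_altdef g(2) flip: lessThan_Suc_atMost) (use g in simp)
  then have yn: "y ^ n = 0 - (\<Sum>k<n. coeff g k * y ^ k)" using y by simp
  have "vge (- c + (of_nat n - 1) * r) (y ^ n)"
    unfolding yn
  proof (intro vge_diff vge_0 vge_sum)
    fix k assume "k \<in> {..<n}"
    then have "of_nat k \<le> (of_nat n - 1 :: rat)" by (simp add: le_diff_eq flip: of_nat_Suc)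
    then have "(of_nat n - 1) * r \<le> of_nat k * r" using rc g(4) by (intro mult_right_mono_neg) auto
    moreover have "vge (- c + of_nat k * r) (coeff g k * y ^ k)"
      using g(3) r(1) by (intro vge_mult vge_power) (auto simp: pvge_def)
    ultimately show "vge (- c + (of_nat n - 1) * r) (coeff g k * y ^ k)" by (elim vge_mono) simp
  qed
  moreover have "ord_t (y ^ n) = of_nat n * r"
    using ord_t_prod[of "{..<n}" "\<lambda>_. y"] y0 by (simp add: r_def)
  ultimately have "- c + (of_nat n - 1) * r \<le> of_nat n * r" using vge_ord_t y0 by (metis power_not_zero)
  then show False using rc by (simp add: algebra_simps)
qed

section \<open>Discriminants of approximations\<close>

lemma pvge_pderiv: "pvge r p \<Longrightarrow> pvge r (pderiv p)" for p :: "'b::idom puiseux poly"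
proof -
  have "vge (0 + r) (of_nat k * x)" if "vge r x" for k and x :: "'b puiseux"
    by (rule vge_mult[OF _ that]) (simp flip: single_of_nat)
  then show "pvge r p \<Longrightarrow> pvge r (pderiv p)" by (auto simp: pvge_def coeff_pderiv simp del: of_nat_Suc)
qed

text \<open>Used in contraposition: a nonzero discriminant forces the approximate roots to be
  distinct. This is why the product formula for resultants has to admit repeated roots.\<close>

lemma resultant_pderiv_lin_prod_not_distinct:
  fixes ys :: "'b::idom list"
  assumes "\<not> distinct ys"
  shows "resultant (lin_prod ys) (pderiv (lin_prod ys)) = 0"
proof -
  obtain xs zs us y where ys: "ys = xs @ [y] @ zs @ [y] @ us" using not_distinct_decomp[OF assms] by blast
  have "lin_prod ys = [:- y, 1:] * ([:- y, 1:] * lin_prod (xs @ zs @ us))"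
    unfolding ys by (simp only: lin_prod_simps) (simp only: mult_1_left mult_1_right ac_simps)
  then have "poly (pderiv (lin_prod ys)) y = 0" by (simp add: pderiv_mult pderiv_pCons del: mult_pCons_left)
  moreover have "y \<in> set ys" by (simp add: ys)
  ultimately show ?thesis unfolding resultant_lin_prod by (auto simp: prod_list_zero_iff)
qed

lemma ord_t_discriminant:
  fixes ys :: "'b::idom puiseux list"
  assumes "distinct ys"
  shows "ord_t (resultant (lin_prod ys) (pderiv (lin_prod ys))) = (\<Sum>y\<in>set ys. \<Sum>z\<in>set ys - {y}. ord_t (y - z))"
proof -
  have lin: "lin_prod ys = (\<Prod>y\<in>set ys. [:- y, 1:])"
    using assms by (simp add: lin_prod_def prod.distinct_set_conv_list)
  have d: "poly (pderiv (lin_prod ys)) y = (\<Prod>z\<in>set ys - {y}. y - z)" if "y \<in> set ys" for y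
  proof -
    have "poly (pderiv (lin_prod ys)) y = (\<Sum>x\<in>set ys. \<Prod>z\<in>set ys - {x}. y - z)"
      unfolding lin pderiv_prod by (simp add: poly_sum poly_prod pderiv_pCons)
    also have "\<dots> = (\<Sum>x\<in>{y}. \<Prod>z\<in>set ys - {x}. y - z)"
      using that by (intro sum.mono_neutral_right) (auto simp: prod_zero_iff)
    finally show ?thesis by simp
  qed
  have "resultant (lin_prod ys) (pderiv (lin_prod ys)) = (\<Prod>y\<in>set ys. \<Prod>z\<in>set ys - {y}. y - z)"
    unfolding resultant_lin_prod prod.distinct_set_conv_list[OF assms, symmetric] by (intro prod.cong refl d)
  also have "ord_t \<dots> = (\<Sum>y\<in>set ys. ord_t (\<Prod>z\<in>set ys - {y}. y - z))"
    by (rule ord_t_prod) (simp add: prod_zero_iff)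
  also have "\<dots> = (\<Sum>y\<in>set ys. \<Sum>z\<in>set ys - {y}. ord_t (y - z))"
    by (intro sum.cong refl ord_t_prod) auto
  finally show ?thesis .
qed

text \<open>The precision exceeds the order of the first resultant by more than the loss in the
  determinant, so the leading term survives.\<close>

lemma resultant_perturb_ord:
  fixes p q :: "'b::comm_ring_1 puiseux poly"
  assumes "degree p' = degree p" "degree q' = degree q" "c \<ge> 0"
    "pvge (- c) p" "pvge (- c) p'" "pvge (- c) q" "pvge (- c) q'" "pvge M (p - p')" "pvge M (q - q')"
    "resultant p q \<noteq> 0" "M > ord_t (resultant p q) + of_nat (degree p + degree q) * c"
  shows "resultant p' q' \<noteq> 0" "ord_t (resultant p' q') = ord_t (resultant p q)"
proof -
  have "vge (M - of_nat (degree p + degree q) * c) (resultant p q - resultant p' q')"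
    by (rule resultant_perturb) (use assms in auto)
  then have "vge (M - of_nat (degree p + degree q) * c) (resultant p' q' - resultant p q)"
    by (simp add: vge_diff_swap)
  then have "vgt (ord_t (resultant p q)) (resultant p' q' - resultant p q)"
    by (rule vge_imp_vgt) (use assms in simp)
  from ord_t_add_higher[OF assms(10) this]
  show "resultant p' q' \<noteq> 0" "ord_t (resultant p' q') = ord_t (resultant p q)" by simp_all
qed

lemma approx_distinct_roots:
  fixes p :: "'a::{alg_closed_field, field_char_0} puiseux poly"
  assumes p: "monic p" "degree p = n" "n > 0" and R: "resultant p (pderiv p) \<noteq> 0"
  obtains c M0 where "c \<ge> 0" "\<And>M. M > M0 \<Longrightarrow> \<exists>Y. finite Y \<and> card Y = n \<and>
    pvge M (p - (\<Prod>y\<in>Y. [:- y, 1:])) \<and> (\<forall>y\<in>Y. vge (- c) y) \<and>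
    (\<Sum>y\<in>Y. \<Sum>z\<in>Y - {y}. ord_t (y - z)) = ord_t (resultant p (pderiv p))"
proof -
  obtain c where c: "c \<ge> 0" "pvge (- c) p" using pvge_exists by blast
  \<comment> \<open>Positivity of \<open>M\<close> lets the approximation inherit the pole bound
    \<open>c\<close> of \<open>p\<close>; the other bound preserves the leading term of the
    resultant.\<close>
  let ?M0 = "max 0 (ord_t (resultant p (pderiv p)) + of_nat (degree p + degree (pderiv p)) * c)"
  have "\<exists>Y. finite Y \<and> card Y = n \<and>
    pvge M (p - (\<Prod>y\<in>Y. [:- y, 1:])) \<and> (\<forall>y\<in>Y. vge (- c) y) \<and>
    (\<Sum>y\<in>Y. \<Sum>z\<in>Y - {y}. ord_t (y - z)) = ord_t (resultant p (pderiv p))" if M: "M > ?M0" for M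
  proof -
    obtain ys where ys: "length ys = n" "pvge M (p - lin_prod ys)"
      using newton_puiseux_approx[OF p(1)] p(2) unfolding splits_approx_def by metis
    let ?g = "lin_prod ys"
    have "pvge (- c) (p - ?g)" using pvge_mono[OF ys(2), of "- c"] c(1) M by simp
    from pvge_diff[OF c(2) this] have gc: "pvge (- c) ?g" by simp
    have "pvge M (pderiv (p - ?g))" using ys(2) by (rule pvge_pderiv)
    then have dM: "pvge M (pderiv p - pderiv ?g)" by (simp add: pderiv_diff)
    have "M > ord_t (resultant p (pderiv p)) + of_nat (degree p + degree (pderiv p)) * c" using M by simp
    note res = resultant_perturb_ord[OF _ _ c(1,2) gc pvge_pderiv[OF c(2)] pvge_pderiv[OF gc] ys(2) dM R this]
    have dg: "degree ?g = degree p" "degree (pderiv ?g) = degree (pderiv p)"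
      using ys(1) p(2) by (simp_all add: degree_pderiv)
    have dist: "distinct ys" using resultant_pderiv_lin_prod_not_distinct[of ys] res(1)[OF dg] by blast
    have lin: "?g = (\<Prod>y\<in>set ys. [:- y, 1:])"
      using dist by (simp add: lin_prod_def prod.distinct_set_conv_list)
    have "vge (- c) y" if "y \<in> set ys" for y
    proof (rule approx_root_bound[OF monic_lin_prod _ gc c(1)])
      show "degree ?g = n" using ys(1) by simp
      show "poly ?g y = 0" using that by (auto simp: poly_lin_prod prod_list_zero_iff)
    qed
    moreover have "pvge M (p - (\<Prod>y\<in>set ys. [:- y, 1:]))" using ys(2) by (simp only: lin)
    moreover have "card (set ys) = n" using dist ys(1) distinct_card by metis
    ultimately show ?thesis using ord_t_discriminant[OF dist] res(2)[OF dg] by (intro exI[of _ "set ys"]) simp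
  qed
  with c(1) show ?thesis by (rule that)
qed

text \<open>One order can exceed the total only if others are negative, and each of those is at
  least \<open>- c\<close>; there are at most \<open>card Y * card Y\<close> pairs.\<close>

lemma pair_ord_bound:
  fixes Y :: "'b::ab_group_add puiseux set"
  assumes Y: "finite Y" "\<And>y. y \<in> Y \<Longrightarrow> vge (- c) y" and c: "c \<ge> 0" and yz: "y \<in> Y" "z \<in> Y" "y \<noteq> z"
  shows "ord_t (y - z) \<le> (\<Sum>y\<in>Y. \<Sum>z\<in>Y - {y}. ord_t (y - z)) + of_nat (card Y * card Y) * c"
    and "- c \<le> ord_t (y - z)"
proof -
  have lower: "- c \<le> ord_t (u - v)" if "u \<in> Y" "v \<in> Y" "u \<noteq> v" for u v
    using that Y(2) by (intro vge_ord_t vge_diff) auto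
  then show "- c \<le> ord_t (y - z)" using yz by blast
  define P where "P = (SIGMA y:Y. Y - {y})"
  have P: "finite P" "(y, z) \<in> P" using Y yz by (auto simp: P_def)
  have "card P \<le> card (Y \<times> Y)" using Y(1) by (intro card_mono) (auto simp: P_def)
  then have "card (P - {(y, z)}) \<le> card Y * card Y" using P by (simp add: card_cartesian_product)
  then have "of_nat (card (P - {(y, z)})) * c \<le> of_nat (card Y * card Y) * c"
    using c by (intro mult_right_mono of_nat_mono) auto
  moreover have "(\<Sum>y\<in>Y. \<Sum>z\<in>Y - {y}. ord_t (y - z)) = (\<Sum>(u, v)\<in>P. ord_t (u - v))"
    unfolding P_def using Y(1) by (subst sum.Sigma) auto
  moreover have "\<dots> = ord_t (y - z) + (\<Sum>(u, v)\<in>P - {(y, z)}. ord_t (u - v))"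
    using sum.remove[OF P, of "\<lambda>(u, v). ord_t (u - v)"] by simp
  moreover have "of_nat (card (P - {(y, z)})) * (- c) \<le> (\<Sum>(u, v)\<in>P - {(y, z)}. ord_t (u - v))"
    by (rule sum_bounded_below) (auto simp: P_def intro: lower)
  ultimately show "ord_t (y - z) \<le> (\<Sum>y\<in>Y. \<Sum>z\<in>Y - {y}. ord_t (y - z)) + of_nat (card Y * card Y) * c"
    by linarith
qed

text \<open>Leaves on two different branches first differ at \<delta>. So bounds on the orders of
  differences apply to \<delta>, and a pole bound for the leaves passes to the truncation.\<close>

lemma branch_node_pair:
  fixes Y :: "'b::ab_group_add puiseux set"
  assumes "\<sigma> \<in> branch_nodes Y" "finite Y"
  obtains y z where "y \<in> Y" "z \<in> Y" "y \<noteq> z" "snd \<sigma> = ord_t (y - z)" "fst \<sigma> = trunc (snd \<sigma>) y"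
proof -
  obtain a \<delta> where \<sigma>: "\<sigma> = (a, \<delta>)" by (cases \<sigma>)
  have node: "is_node (a, \<delta>)" and card: "card (branches Y \<sigma>) > 1"
    using assms(1) by (auto simp: branch_nodes_def \<sigma>)
  obtain u v where uv: "u \<in> branches Y \<sigma>" "v \<in> branches Y \<sigma>" "u \<noteq> v"
    using card by (metis card_le_Suc0_iff_eq One_nat_def not_less assms(2) branches_def disc_def finite_imageI finite_subset mem_Collect_eq subsetI card.infinite not_less_zero)
  obtain y z where y: "y \<in> Y" "vge \<delta> (y - a)" "u = lookup y \<delta>" and z: "z \<in> Y" "vge \<delta> (z - a)" "v = lookup z \<delta>"
    using uv by (auto simp: branches_def disc_def \<sigma>)
  have "vge \<delta> (y - z)" using vge_diff_trans[OF y(2), of z] z(2) by (simp add: vge_diff_swap)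
  then have "ord_t (y - z) = \<delta>" using uv y z by (intro ord_t_eqI) (auto simp: lookup_minus)
  moreover have "a = trunc \<delta> y" using node_eq_trunc[OF node y(2)] .
  ultimately show ?thesis using that[of y z] y z uv by (auto simp: \<sigma>)
qed

section \<open>The intersection number\<close>

text \<open>A nonzero constant coefficient excludes positive order. An order of at most 0, unlike
  mere nonvanishing, gives a precision that suffices for all such products.\<close>

lemma prod_list_ord_t_nonpos:
  fixes xs :: "'b::idom puiseux list"
  assumes "\<And>x. x \<in> set xs \<Longrightarrow> lookup x 0 \<noteq> 0"
  shows "prod_list xs \<noteq> 0 \<and> ord_t (prod_list xs) \<le> 0"
  using assms
proof (induction xs)
  case (Cons x xs)
  have "lookup x 0 \<noteq> 0" using Cons.prems by simp
  then have "x \<noteq> 0" "ord_t x \<le> 0" by (auto intro: ord_t_le)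
  moreover have "prod_list xs \<noteq> 0" "ord_t (prod_list xs) \<le> 0" using Cons by auto
  ultimately show ?case by (simp add: ord_t_mult)
qed (simp add: ord_t_one)

lemma degree_minus_const: "degree p > 0 \<Longrightarrow> degree (p - [:c:]) = degree p" for p :: "'b::ab_group_add poly"
  unfolding diff_conv_add_uminus by (rule degree_add_eq_left) simp

text \<open>The roots of the derivative are only known approximately, so nonvanishing must be
  transferred back from \<open>g\<close> to \<open>pderiv p\<close>. The roots \<open>rs\<close>,
  and with them \<open>X\<close>, have to be fixed before \<xi>, so the precision must serve all
  \<xi> at once.\<close>

lemma generic_resultant_nonzero:
  fixes p :: "'a::{alg_closed_field, field_char_0} puiseux poly"
  assumes p: "monic p" "degree p = n" "n > 0"
  shows "\<exists>X. finite X \<and> (\<forall>\<xi>. \<xi> \<notin> X \<longrightarrow> resultant (p - [:Poly_Mapping.single 0 \<xi>:]) (pderiv p) \<noteq> 0)"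
proof -
  let ?k = "Poly_Mapping.single 0 (of_nat n) :: 'a puiseux" and ?k' = "Poly_Mapping.single 0 (1 / of_nat n) :: 'a puiseux"
  have kk: "?k' * ?k = 1" "?k * ?k' = 1" using p(3) by (simp_all add: mult_single del: single_of_nat)
  obtain c c' where c: "c \<ge> 0" "pvge (- c) p" and c': "c' \<ge> 0" "pvge (- c') (pderiv p)"
    using pvge_exists[of p] pvge_exists[of "pderiv p"] by blast
  define C where "C = max c c'"
  have C: "C \<ge> 0" "pvge (- C) p" "pvge (- C) (pderiv p)"
    using c c' by (auto simp: C_def intro: pvge_mono)
  define q where "q = smult ?k' (pderiv p)"
  have dp: "degree (pderiv p) = n - 1" using p by (simp add: degree_pderiv)
  have k'0: "?k' \<noteq> 0" using p(3) by (subst single_hom.hom_0_iff) simp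
  have dq: "degree q = n - 1" unfolding q_def using dp k'0 by simp
  have "lead_coeff q = ?k' * (of_nat n * coeff p n)"
    unfolding dq unfolding q_def using p(3) by (simp add: coeff_pderiv del: of_nat_Suc)
  also have "\<dots> = 1" using kk p by (simp flip: single_of_nat)
  finally have mq: "monic q" .
  have kq: "smult ?k q = pderiv p" by (simp add: q_def kk(2) del: single_of_nat)
  \<comment> \<open>The size of the Sylvester matrix times the pole bound \<open>C\<close>, plus 1
    to exceed strictly a resultant of order at most 0. Subtracting a constant from \<open>p\<close>
    leaves \<open>C\<close> valid because \<open>C\<close> is nonnegative.\<close>
  define M where "M = of_nat (n + (n - 1)) * C + 1"
  have M: "M > 0" using C(1) by (simp add: M_def add_nonneg_pos)
  obtain rs where rs: "length rs = n - 1" "pvge M (q - lin_prod rs)"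
    using newton_puiseux_approx[OF mq] dq unfolding splits_approx_def by metis
  define g where "g = smult ?k (lin_prod rs)"
  have "pvge (0 + M) (smult ?k (q - lin_prod rs))" by (rule pvge_smult[OF _ rs(2)]) (simp del: single_of_nat)
  then have gM: "pvge M (pderiv p - g)" unfolding g_def kq[symmetric] by (simp add: smult_diff_right del: single_of_nat)
  have k0: "?k \<noteq> 0" using p(3) by simp
  have dg: "degree g = n - 1" unfolding g_def using k0 rs(1) by simp
  have "pvge (- C) (pderiv p - g)" using pvge_mono[OF gM, of "- C"] C(1) M by simp
  from pvge_diff[OF C(3) this] have gC: "pvge (- C) g" by simp
  define X where "X = (\<lambda>r. lookup (poly p r) 0) ` set rs"
  have "resultant (p - [:Poly_Mapping.single 0 \<xi>:]) (pderiv p) \<noteq> 0" if \<xi>: "\<xi> \<notin> X" for \<xi>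
  proof -
    let ?p = "p - [:Poly_Mapping.single 0 \<xi>:]"
    have d: "degree ?p = n" using p by (simp add: degree_minus_const)
    have "pvge (- C) [:Poly_Mapping.single 0 \<xi>:]" using C(1) by (auto simp: pvge_def coeff_pCons split: nat.split)
    then have pC: "pvge (- C) ?p" using C(2) by (rule pvge_diff[rotated])
    have "prod_list (map (poly ?p) rs) \<noteq> 0 \<and> ord_t (prod_list (map (poly ?p) rs)) \<le> 0"
      using \<xi> by (intro prod_list_ord_t_nonpos) (auto simp: X_def lookup_minus)
    moreover have "resultant ?p (lin_prod rs) = (- 1) ^ (degree ?p * length rs) * prod_list (map (poly ?p) rs)"
      by (subst resultant_swap) (simp only: resultant_lin_prod degree_lin_prod)
    moreover have "ord_t ((- 1 :: 'a puiseux) ^ k) = 0" for k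
      by (induction k) (auto simp: ord_t_one ord_t_uminus)
    ultimately have 1: "resultant ?p (lin_prod rs) \<noteq> 0" "ord_t (resultant ?p (lin_prod rs)) \<le> 0"
      by (simp_all add: ord_t_mult)
    have r: "resultant ?p g = ?k ^ n * resultant ?p (lin_prod rs)"
      unfolding g_def by (simp add: resultant_smult_right[OF k0] d del: single_of_nat)
    moreover have "ord_t (?k ^ n) = 0"
      using p(3) by (intro ord_t_eqI) (simp_all add: single_power del: single_of_nat)
    ultimately have 2: "resultant ?p g \<noteq> 0" "ord_t (resultant ?p g) \<le> 0"
      using 1 k0 by (simp_all add: ord_t_mult del: single_of_nat)
    have "pvge M (g - pderiv p)" using gM pvge_diff[OF pvge_0 gM] by simp
    then show ?thesis
      by (intro resultant_perturb_ord(1)[of ?p ?p "pderiv p" g C M, OF refl _ C(1) pC pC gC C(3)])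
        (use 2 d dg dp in \<open>simp_all add: M_def\<close>)
  qed
  moreover have "finite X" by (simp add: X_def)
  ultimately show ?thesis by blast
qed

section \<open>The formula for polynomials with nonzero discriminant\<close>

lemma resultant_subst_t:
  fixes h :: "'a::field_char_0 poly poly"
  shows "resultant (map_poly subst_t h) (pderiv (map_poly subst_t h)) = subst_t (resultant h (pderiv h))"
proof -
  have "pderiv (map_poly subst_t h) = map_poly subst_t (pderiv h)"
    by (rule poly_eqI) (simp add: coeff_pderiv coeff_map_poly subst_t_hom.hom_mult subst_t_hom.hom_add subst_t_hom.hom_of_nat)
  then show ?thesis by (simp add: subst_t_hom.resultant_hom)
qed

lemma split_pi_roots_sum:
  fixes h :: "'a::{alg_closed_field, field_char_0} poly poly"
  assumes h: "monic h" "degree h = n" "n > 0" and R: "resultant h (pderiv h) \<noteq> 0"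
  defines "S \<equiv> {\<sigma>. is_split_pi_root h \<sigma>}"
  shows "finite S" "- rat_of_nat (degree (resultant h (pderiv h))) =
    (\<Sum>\<sigma>\<in>S. (rat_of_nat (n_roots (lead_pi h \<sigma>)) - 1) * lam h \<sigma>)"
proof -
  let ?p = "map_poly subst_t h"
  let ?D = "ord_t (resultant ?p (pderiv ?p))"
  have p: "monic ?p" "degree ?p = n" using h by (simp_all add: coeff_map_poly)
  have D: "?D = - rat_of_nat (degree (resultant h (pderiv h)))" "resultant ?p (pderiv ?p) \<noteq> 0"
    using R by (simp_all add: resultant_subst_t ord_t_subst_t)
  obtain c M0 where c: "c \<ge> 0" and approx: "\<And>M. M > M0 \<Longrightarrow> \<exists>Y. finite Y \<and> card Y = n \<and>
    pvge M (?p - (\<Prod>y\<in>Y. [:- y, 1:])) \<and> (\<forall>y\<in>Y. vge (- c) y) \<and>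
    (\<Sum>y\<in>Y. \<Sum>z\<in>Y - {y}. ord_t (y - z)) = ?D"
    by (rule approx_distinct_roots[OF p h(3) D(2)]) blast
  have "\<exists>m. \<forall>Y M. \<sigma> \<in> S \<longrightarrow> M > m \<longrightarrow> finite Y \<longrightarrow> card Y = n \<longrightarrow> pvge M (?p - (\<Prod>y\<in>Y. [:- y, 1:])) \<longrightarrow>
      \<sigma> \<in> branch_nodes Y" for \<sigma>
  proof -
    obtain b where b: "b \<ge> 0" "vge (- b) (fst \<sigma>)" using vge_exists by blast
    define b' where "b' = max b (- snd \<sigma>)"
    have b': "b' \<ge> 0" "vge (- b') (fst \<sigma>)" "- b' \<le> snd \<sigma>"
      using b by (auto simp: b'_def intro: vge_mono)
    show ?thesis
    proof (intro exI[of _ "of_nat n * snd \<sigma> + of_nat n * b'"] allI impI)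
      fix Y M assume *: "\<sigma> \<in> S" "M > of_nat n * snd \<sigma> + of_nat n * b'" "finite Y" "card Y = n"
        "pvge M (?p - (\<Prod>y\<in>Y. [:- y, 1:]))"
      have "is_node \<sigma>" using *(1) by (simp add: S_def is_split_pi_root_def is_pi_root_def is_node_def)
      from split_iff_branch_node(1)[OF *(3) this _ *(5) b'] *(1,2,4) h(2)
      show "\<sigma> \<in> branch_nodes Y" by (simp add: S_def)
    qed
  qed
  then obtain m where m: "\<And>\<sigma> Y M. \<sigma> \<in> S \<Longrightarrow> M > m \<sigma> \<Longrightarrow> finite Y \<Longrightarrow> card Y = n \<Longrightarrow>
      pvge M (?p - (\<Prod>y\<in>Y. [:- y, 1:])) \<Longrightarrow> \<sigma> \<in> branch_nodes Y"
    by metis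
  have node_count: "finite (branch_nodes Y) \<and> card (branch_nodes Y) \<le> n" if "finite Y" "card Y = n" for Y :: "'a puiseux set"
  proof -
    have "Y \<noteq> {}" using that h(3) by auto
    then obtain y where "y \<in> Y" by blast
    then show ?thesis using branch_nodes_sum[OF that(1)] that(2) by auto
  qed
  have bounded: "\<exists>M > max m0 M0. \<forall>\<sigma>\<in>A. M > m \<sigma>" if "finite A" for A m0
  proof (intro exI conjI ballI)
    let ?M = "Max (insert (max m0 M0) (m ` A)) + 1"
    have "x < ?M" if "x \<in> insert (max m0 M0) (m ` A)" for x
      using Max_ge[OF _ that] \<open>finite A\<close> by simp
    then show "?M > max m0 M0" "\<sigma> \<in> A \<Longrightarrow> ?M > m \<sigma>" for \<sigma> by blast+
  qed
  txt \<open>How large \<open>M\<close> must be depends on the \<open>\<pi>\<close>-root, so finiteness of \<open>S\<close> comes first: every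
    finite subset consists of branch nodes for a common \<open>M\<close>, and there are at most \<open>n\<close> of those.\<close>
  show fin: "finite S"
  proof (rule ccontr)
    assume "infinite S"
    then obtain A where A: "A \<subseteq> S" "finite A" "card A = Suc n" using infinite_arbitrarily_large by blast
    obtain M where M: "M > M0" "\<And>\<sigma>. \<sigma> \<in> A \<Longrightarrow> M > m \<sigma>" using bounded[OF A(2), of 0] by auto
    obtain Y where Y: "finite Y" "card Y = n" "pvge M (?p - (\<Prod>y\<in>Y. [:- y, 1:]))" using approx[OF M(1)] by blast
    have "A \<subseteq> branch_nodes Y" using m[OF _ M(2) Y] A(1) by blast
    then have "card A \<le> n" using node_count[OF Y(1,2)] by (meson card_mono order.trans)
    then show False using A(3) by simp
  qed
  \<comment> \<open>An upper bound for \<delta> at the branch nodes of every admissible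
    \<open>Y\<close>, available before \<open>M\<close> and \<open>Y\<close> are chosen.\<close>
  define B where "B = ?D + of_nat (n * n) * c"
  obtain M where M: "M > M0" "M > of_nat n * B + of_nat n * c" "\<And>\<sigma>. \<sigma> \<in> S \<Longrightarrow> M > m \<sigma>"
    using bounded[OF fin, of "of_nat n * B + of_nat n * c"] by auto
  obtain Y where Y: "finite Y" "card Y = n" "pvge M (?p - (\<Prod>y\<in>Y. [:- y, 1:]))" "\<And>y. y \<in> Y \<Longrightarrow> vge (- c) y"
    "(\<Sum>y\<in>Y. \<Sum>z\<in>Y - {y}. ord_t (y - z)) = ?D" using approx[OF M(1)] by blast
  have split: "\<sigma> \<in> S" "n_roots (lead_pi h \<sigma>) = card (branches Y \<sigma>)" "lam h \<sigma> = (\<Sum>y\<in>Y. contact \<sigma> y)"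
    if \<sigma>: "\<sigma> \<in> branch_nodes Y" for \<sigma>
  proof -
    obtain y z where yz: "y \<in> Y" "z \<in> Y" "y \<noteq> z" "snd \<sigma> = ord_t (y - z)" "fst \<sigma> = trunc (snd \<sigma>) y"
      by (rule branch_node_pair[OF \<sigma> Y(1)])
    have b: "snd \<sigma> \<le> B" "- c \<le> snd \<sigma>"
      using pair_ord_bound[OF Y(1,4) c yz(1-3)] by (simp_all add: B_def yz(4) Y(2,5))
    have v: "vge (- c) (fst \<sigma>)"
      unfolding yz(5) using Y(4)[OF yz(1)] by (auto simp: vge_def lookup_trunc split: if_splits)
    have "of_nat n * snd \<sigma> \<le> of_nat n * B" using b(1) by (intro mult_left_mono) auto
    then have "M > of_nat (card Y) * snd \<sigma> + of_nat (card Y) * c" using M(2) by (simp add: Y(2))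
    note * = split_iff_branch_node[OF Y(1) _ _ Y(3) c v b(2) this]
    have "is_node \<sigma>" using \<sigma> by (simp add: branch_nodes_def)
    then show "\<sigma> \<in> S" "n_roots (lead_pi h \<sigma>) = card (branches Y \<sigma>)" "lam h \<sigma> = (\<Sum>y\<in>Y. contact \<sigma> y)"
      using * \<sigma> h(2) Y(2) by (simp_all add: S_def)
  qed
  have S: "S = branch_nodes Y" using split(1) m[OF _ M(3) Y(1-3)] by blast
  have "(\<Sum>\<sigma>\<in>S. (rat_of_nat (n_roots (lead_pi h \<sigma>)) - 1) * lam h \<sigma>) =
      (\<Sum>\<sigma>\<in>branch_nodes Y. \<Sum>y\<in>Y. (rat_of_nat (card (branches Y \<sigma>)) - 1) * contact \<sigma> y)"
    unfolding S by (intro sum.cong refl) (simp add: split sum_distrib_left)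
  also have "\<dots> = (\<Sum>y\<in>Y. \<Sum>\<sigma>\<in>branch_nodes Y. (rat_of_nat (card (branches Y \<sigma>)) - 1) * contact \<sigma> y)"
    by (rule sum.swap)
  also have "\<dots> = (\<Sum>y\<in>Y. \<Sum>z\<in>Y - {y}. ord_t (y - z))"
    using branch_nodes_sum[OF Y(1)] by (intro sum.cong refl) blast
  finally show "- rat_of_nat (degree (resultant h (pderiv h))) =
    (\<Sum>\<sigma>\<in>S. (rat_of_nat (n_roots (lead_pi h \<sigma>)) - 1) * lam h \<sigma>)" by (simp add: Y(5) D(1))
qed

text \<open>Settles degree 0 in \<open>y\<close>, where \<open>f\<close> is 1. For
  \<open>c = 0\<close> the value at \<sigma> is 0, and otherwise the leading coefficient is free of
  \<pi>; both are excluded for a \<pi>-root.\<close>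

lemma no_pi_root_const: "\<not> is_pi_root [:[:c:]:] \<sigma>"
proof
  assume "is_pi_root [:[:c:]:] \<sigma>"
  moreover have "map_poly subst_x [:[:c:]:] = [:Poly_Mapping.single 0 [:c:]:]"
    by (rule poly_eqI) (simp add: coeff_map_poly coeff_pCons subst_x_def tpow_def split: nat.split)
  then have "eval_at [:[:c:]:] s = Poly_Mapping.single 0 [:c:]" for s by (simp add: eval_at_def)
  ultimately show False
    by (auto simp: is_pi_root_def lead_pi_def Let_def lookup_single when_def split: if_splits)
qed

theorem theorem3p4:
  fixes f :: "'a::{alg_closed_field, field_char_0} poly poly"
  assumes "lead_coeff f = 1"
  shows "\<exists>F::'a set. finite F \<and> (\<forall>\<xi>. \<xi> \<notin> F \<longrightarrow>
           (let f\<^sub>\<xi> = f - [:[:\<xi>:]:];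
                S = {\<sigma>. is_split_pi_root f\<^sub>\<xi> \<sigma>}
            in finite S \<and>
               rat_of_nat (int_num f\<^sub>\<xi> (pderiv f)) =
                 - (\<Sum>\<sigma>\<in>S. (rat_of_nat (n_roots (lead_pi f\<^sub>\<xi> \<sigma>)) - 1) * lam f\<^sub>\<xi> \<sigma>)))"
proof (cases "degree f = 0")
  case True
  then have f: "f = 1" using assms monic_degree_0 by blast
  show ?thesis
  proof (intro exI[of _ "{}"] conjI allI impI finite.emptyI)
    fix \<xi> :: 'a
    have e: "f - [:[:\<xi>:]:] = [:[:1 - \<xi>:]:]"
      by (simp only: f one_pCons diff_pCons diff_0_right)
    have S: "{\<sigma>. is_split_pi_root (f - [:[:\<xi>:]:]) \<sigma>} = {}"
      unfolding e is_split_pi_root_def using no_pi_root_const[of "1 - \<xi>"] by blast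
    have "int_num (f - [:[:\<xi>:]:]) (pderiv f) = 0" unfolding e int_num_def resultant_const by (simp add: f)
    then show "let f\<^sub>\<xi> = f - [:[:\<xi>:]:];
                S = {\<sigma>. is_split_pi_root f\<^sub>\<xi> \<sigma>}
            in finite S \<and>
               rat_of_nat (int_num f\<^sub>\<xi> (pderiv f)) =
                 - (\<Sum>\<sigma>\<in>S. (rat_of_nat (n_roots (lead_pi f\<^sub>\<xi> \<sigma>)) - 1) * lam f\<^sub>\<xi> \<sigma>)"
      unfolding Let_def S by simp
  qed
next
  case False
  let ?p = "map_poly subst_t f"
  have "monic ?p" "degree ?p > 0" using assms False by (simp_all add: coeff_map_poly)
  from generic_resultant_nonzero[OF this(1) refl this(2)]
  obtain X where X: "finite X" "\<And>\<xi>. \<xi> \<notin> X \<Longrightarrow> resultant (?p - [:Poly_Mapping.single 0 \<xi>:]) (pderiv ?p) \<noteq> 0" by blast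
  show ?thesis
  proof (intro exI[of _ X] conjI X(1) allI impI)
    fix \<xi> assume \<xi>: "\<xi> \<notin> X"
    let ?h = "f - [:[:\<xi>:]:]"
    have d: "degree ?h = degree f" using False by (simp add: degree_minus_const)
    \<comment> \<open>The derivative does not see \<xi>, so the intersection number is the degree of
      the resultant of \<open>?h\<close> with its own derivative.\<close>
    have pd: "pderiv ?h = pderiv f" by (simp add: pderiv_diff)
    have h: "monic ?h" using assms False unfolding d by (cases "degree f") auto
    have "map_poly subst_t [:[:\<xi>:]:] = [:Poly_Mapping.single 0 \<xi>:]"
      by (rule poly_eqI) (simp add: coeff_map_poly coeff_pCons subst_t_const split: nat.split)
    then have e: "map_poly subst_t ?h = ?p - [:Poly_Mapping.single 0 \<xi>:]"
      by (simp only: map_subst_t_hom.hom_minus)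
    have "subst_t (resultant ?h (pderiv ?h)) \<noteq> 0"
      using X(2)[OF \<xi>] unfolding resultant_subst_t[symmetric] e by (simp add: pderiv_diff)
    then have "resultant ?h (pderiv ?h) \<noteq> 0" by auto
    from split_pi_roots_sum[OF h d _ this] False
    show "let f\<^sub>\<xi> = f - [:[:\<xi>:]:];
                S = {\<sigma>. is_split_pi_root f\<^sub>\<xi> \<sigma>}
            in finite S \<and>
               rat_of_nat (int_num f\<^sub>\<xi> (pderiv f)) =
                 - (\<Sum>\<sigma>\<in>S. (rat_of_nat (n_roots (lead_pi f\<^sub>\<xi> \<sigma>)) - 1) * lam f\<^sub>\<xi> \<sigma>)"
      by (simp add: Let_def int_num_def pd equation_minus_iff)
  qed
qed

end
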